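(* Let $(X,\mu)$ be a standard (non-atomic) probability space and let $G$ be a quasi non-archimedean Polish group. Then $\mathrm{L}^0(X,\mu,G)$ is quasi non-archimedean. In particular, any quasi non-archimedean Polish group embeds (as a topological group) in a connected quasi non-archimedean Polish group.
   Context: A Polish group is a separable topological group whose topology admits a compatible complete metric. A standard probability space is a probability space isomorphic to $[0,1]$ with its Borel $\sigma$-algebra and the Lebesgue measure. For a Polish group $G$, $\mathrm{L}^0(X,\mu,G)$ is the group (under pointwise multiplication) of measurable maps from $X$ to $G$, two maps being identified if they coincide on a set of full measure, equipped with the topology of convergence in measure: a basis of neighborhoods of the identity is given by the sets $\tilde U_\epsilon=\{f\in\mathrm{L}^0(X,\mu,G): \mu(\{x\in X: f(x)\notin U\})<\epsilon\}$, where $U$ is an open neighborhood of the identity in $G$ and $\epsilon>0$. It is a Polish group. A topological group $G$ is quasi non-archimedean if for every $n\in\mathbb{N}$ and every neighborhood of the identity $V\subseteq G$, there exists a neighborhood of the identity $U\subseteq V$ such that for all $g_1,\dots,g_n\in U$, the group generated by $g_1,\dots,g_n$ is contained in $V$. *)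

theory Defs
  imports "HOL-Probability.Probability" "HOL-Algebra.Generated_Groups"
begin

text \<open>
  Groups are carrier-based (HOL-Algebra) and carry an abstract topology, because the group of
  measurable maps modulo almost everywhere equality is a quotient whose carrier is not a type.
\<close>

definition topological_group :: "('a, 'b) monoid_scheme \<Rightarrow> 'a topology \<Rightarrow> bool" where
  "topological_group G T \<longleftrightarrow>
     group G \<and> topspace T = carrier G \<and>
     continuous_map (prod_topology T T) T (\<lambda>(x, y). x \<otimes>\<^bsub>G\<^esub> y) \<and>
     continuous_map T T (\<lambda>x. inv\<^bsub>G\<^esub> x)"

definition polish_group :: "('a, 'b) monoid_scheme \<Rightarrow> 'a topology \<Rightarrow> bool" where
  "polish_group G T \<longleftrightarrow>
     topological_group G T \<and> separable_space T \<and> completely_metrizable_space T"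

text \<open>Neighbourhoods need not be open.\<close>

definition nhd_of :: "'a topology \<Rightarrow> 'a \<Rightarrow> 'a set \<Rightarrow> bool" where
  "nhd_of T a V \<longleftrightarrow> V \<subseteq> topspace T \<and> (\<exists>W. openin T W \<and> a \<in> W \<and> W \<subseteq> V)"

definition quasi_non_archimedean :: "('a, 'b) monoid_scheme \<Rightarrow> 'a topology \<Rightarrow> bool" where
  "quasi_non_archimedean G T \<longleftrightarrow>
     topological_group G T \<and>
     (\<forall>n::nat. \<forall>V. nhd_of T \<one>\<^bsub>G\<^esub> V \<longrightarrow>
        (\<exists>U. nhd_of T \<one>\<^bsub>G\<^esub> U \<and> U \<subseteq> V \<and>
           (\<forall>g :: nat \<Rightarrow> 'a. (\<forall>i<n. g i \<in> U) \<longrightarrow> generate G (g ` {..<n}) \<subseteq> V)))"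

definition topological_group_embedding ::
  "('a, 'c) monoid_scheme \<Rightarrow> 'a topology \<Rightarrow> ('b, 'd) monoid_scheme \<Rightarrow> 'b topology \<Rightarrow> ('a \<Rightarrow> 'b) \<Rightarrow> bool"
  where
  "topological_group_embedding G T H S \<phi> \<longleftrightarrow> \<phi> \<in> hom G H \<and> embedding_map T S \<phi>"

definition measure_space_isomorphism :: "'a measure \<Rightarrow> 'b measure \<Rightarrow> ('a \<Rightarrow> 'b) \<Rightarrow> bool" where
  "measure_space_isomorphism M N f \<longleftrightarrow>
     bij_betw f (space M) (space N) \<and>
     f \<in> measurable M N \<and> inv_into (space M) f \<in> measurable N M \<and>
     (\<forall>A\<in>sets N. emeasure N A = emeasure M (f -` A \<inter> space M))"

text \<open>Non-atomicity is inherited from the unit interval.\<close>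

definition standard_prob_space :: "'a measure \<Rightarrow> bool" where
  "standard_prob_space M \<longleftrightarrow>
     prob_space M \<and>
     (\<exists>f. measure_space_isomorphism M (restrict_space lborel {0..1::real}) f)"

definition borel_of :: "'a topology \<Rightarrow> 'a measure" where
  "borel_of T = sigma (topspace T) {U. openin T U}"

text \<open>
  Elements of \<open>measurable M N\<close> are total functions, unconstrained outside \<open>space M\<close>;
  almost everywhere equality disregards those values.
\<close>

definition ae_eq_rel :: "'x measure \<Rightarrow> 'a topology \<Rightarrow> (('x \<Rightarrow> 'a) \<times> ('x \<Rightarrow> 'a)) set" where
  "ae_eq_rel M T =
     {(f, g). f \<in> measurable M (borel_of T) \<and> g \<in> measurable M (borel_of T) \<and>
              (AE x in M. f x = g x)}"

definition L0_group ::
  "'x measure \<Rightarrow> ('a, 'b) monoid_scheme \<Rightarrow> 'a topology \<Rightarrow> ('x \<Rightarrow> 'a) set monoid" where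
  "L0_group M G T =
     \<lparr> carrier = measurable M (borel_of T) // ae_eq_rel M T,
       mult = (\<lambda>A B. \<Union>f\<in>A. \<Union>g\<in>B. ae_eq_rel M T `` {\<lambda>x. f x \<otimes>\<^bsub>G\<^esub> g x}),
       one = ae_eq_rel M T `` {\<lambda>x. \<one>\<^bsub>G\<^esub>} \<rparr>"

definition L0_basic_nhd ::
  "'x measure \<Rightarrow> ('a, 'b) monoid_scheme \<Rightarrow> 'a topology \<Rightarrow> 'a set \<Rightarrow> real \<Rightarrow> ('x \<Rightarrow> 'a) set set" where
  "L0_basic_nhd M G T U \<epsilon> =
     {A \<in> carrier (L0_group M G T). \<exists>f\<in>A. measure M {x \<in> space M. f x \<notin> U} < \<epsilon>}"

text \<open>
  The group topology with the sets above as a basis of neighbourhoods of the identity: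
  a set is open iff it contains a translate of a basic neighbourhood around each of its points.
\<close>

definition L0_open ::
  "'x measure \<Rightarrow> ('a, 'b) monoid_scheme \<Rightarrow> 'a topology \<Rightarrow> ('x \<Rightarrow> 'a) set set \<Rightarrow> bool" where
  "L0_open M G T W \<longleftrightarrow>
     W \<subseteq> carrier (L0_group M G T) \<and>
     (\<forall>A\<in>W. \<exists>U \<epsilon>. openin T U \<and> \<one>\<^bsub>G\<^esub> \<in> U \<and> 0 < \<epsilon> \<and>
        (\<lambda>B. A \<otimes>\<^bsub>L0_group M G T\<^esub> B) ` L0_basic_nhd M G T U \<epsilon> \<subseteq> W)"

definition L0_topology ::
  "'x measure \<Rightarrow> ('a, 'b) monoid_scheme \<Rightarrow> 'a topology \<Rightarrow> ('x \<Rightarrow> 'a) set topology" where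
  "L0_topology M G T = topology (L0_open M G T)"

lemma openin_borel_of: "openin T U \<Longrightarrow> U \<in> sets (borel_of T)"
  unfolding borel_of_def
  by (subst sets_measure_of) (auto dest: openin_subset)

lemma L0_basic_nhd_mono:
  assumes "finite_measure M" "openin T U" "U \<subseteq> U'" "\<epsilon> \<le> \<epsilon>'"
  shows "L0_basic_nhd M G T U \<epsilon> \<subseteq> L0_basic_nhd M G T U' \<epsilon>'"
proof
  interpret finite_measure M by fact
  fix A assume A: "A \<in> L0_basic_nhd M G T U \<epsilon>"
  then obtain f where f: "f \<in> A" "measure M {x \<in> space M. f x \<notin> U} < \<epsilon>"
    and Ac: "A \<in> carrier (L0_group M G T)"
    by (auto simp: L0_basic_nhd_def)
  have "f \<in> measurable M (borel_of T)"
    using f(1) Ac by (auto simp: L0_group_def quotient_def ae_eq_rel_def)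
  then have "f -` U \<inter> space M \<in> sets M"
    using openin_borel_of[OF assms(2)] by (rule measurable_sets)
  then have "space M - (f -` U \<inter> space M) \<in> sets M" by blast
  moreover have "space M - (f -` U \<inter> space M) = {x \<in> space M. f x \<notin> U}" by blast
  ultimately have "measure M {x \<in> space M. f x \<notin> U'} \<le> measure M {x \<in> space M. f x \<notin> U}"
    using assms(3) by (intro finite_measure_mono) auto
  then show "A \<in> L0_basic_nhd M G T U' \<epsilon>'"
    using f Ac assms(4) by (force simp: L0_basic_nhd_def)
qed

lemma istopology_L0_open:
  assumes fin: "finite_measure M"
  shows "istopology (L0_open M G T)"
  unfolding istopology_def
proof (intro conjI allI impI)
  fix V W assume V: "L0_open M G T V" and W: "L0_open M G T W"
  show "L0_open M G T (V \<inter> W)"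
    unfolding L0_open_def
  proof (intro conjI ballI)
    show "V \<inter> W \<subseteq> carrier (L0_group M G T)" using V by (auto simp: L0_open_def)
    fix A assume A: "A \<in> V \<inter> W"
    let ?m = "\<lambda>B. A \<otimes>\<^bsub>L0_group M G T\<^esub> B"
    obtain U \<epsilon> where U: "openin T U" "\<one>\<^bsub>G\<^esub> \<in> U" "0 < \<epsilon>" "?m ` L0_basic_nhd M G T U \<epsilon> \<subseteq> V"
      using V A unfolding L0_open_def by blast
    obtain U' \<epsilon>' where U': "openin T U'" "\<one>\<^bsub>G\<^esub> \<in> U'" "0 < \<epsilon>'" "?m ` L0_basic_nhd M G T U' \<epsilon>' \<subseteq> W"
      using W A unfolding L0_open_def by blast
    have o: "openin T (U \<inter> U')" using U(1) U'(1) by (rule openin_Int)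
    have "L0_basic_nhd M G T (U \<inter> U') (min \<epsilon> \<epsilon>') \<subseteq> L0_basic_nhd M G T U \<epsilon>"
      by (rule L0_basic_nhd_mono[OF fin o]) auto
    moreover have "L0_basic_nhd M G T (U \<inter> U') (min \<epsilon> \<epsilon>') \<subseteq> L0_basic_nhd M G T U' \<epsilon>'"
      by (rule L0_basic_nhd_mono[OF fin o]) auto
    ultimately have "?m ` L0_basic_nhd M G T (U \<inter> U') (min \<epsilon> \<epsilon>') \<subseteq> V \<inter> W"
      using U(4) U'(4) by blast
    then show "\<exists>U \<epsilon>. openin T U \<and> \<one>\<^bsub>G\<^esub> \<in> U \<and> 0 < \<epsilon> \<and> ?m ` L0_basic_nhd M G T U \<epsilon> \<subseteq> V \<inter> W"
      using o U(2,3) U'(2,3) by (intro exI[of _ "U \<inter> U'"] exI[of _ "min \<epsilon> \<epsilon>'"]) auto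
  qed
next
  fix \<K> assume K: "\<forall>K\<in>\<K>. L0_open M G T K"
  show "L0_open M G T (\<Union>\<K>)"
    unfolding L0_open_def
  proof (intro conjI ballI)
    show "\<Union>\<K> \<subseteq> carrier (L0_group M G T)" using K by (auto simp: L0_open_def)
    fix A assume "A \<in> \<Union>\<K>"
    then obtain K where "K \<in> \<K>" "A \<in> K" by blast
    then show "\<exists>U \<epsilon>. openin T U \<and> \<one>\<^bsub>G\<^esub> \<in> U \<and> 0 < \<epsilon> \<and>
        (\<lambda>B. A \<otimes>\<^bsub>L0_group M G T\<^esub> B) ` L0_basic_nhd M G T U \<epsilon> \<subseteq> \<Union>\<K>"
      using K unfolding L0_open_def by (meson Union_upper subset_trans)
  qed
qed

lemma openin_L0_topology:
  "finite_measure M \<Longrightarrow> openin (L0_topology M G T) W \<longleftrightarrow> L0_open M G T W"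
  by (simp add: L0_topology_def topology_inverse' istopology_L0_open)

end

theory Submission
  imports Defs
begin

text \<open>
  Fix a complete metric \<open>d \<le> 1\<close> on \<open>G\<close>. On classes of measurable maps, the integral
  \<open>\<integral> d (f x) (g x)\<close> defines a metric. Everything about it rests on one pair of facts
  (\<open>fdist_AE_tendsto\<close>, \<open>fdist_tendsto_AE_subseq\<close>): almost everywhere convergence implies
  convergence in the metric, and convergence in the metric implies almost everywhere convergence
  along a subsequence. Hence any jointly continuous operation of \<open>G\<close>, applied pointwise, is
  continuous for the metric (\<open>continuous_map_L0\<close>), so the classes form a topological group.
  Markov's inequality compares balls around the identity with the neighbourhoods
  \<open>{f. \<mu> {x. f x \<notin> U} < \<epsilon>}\<close>; since translations are continuous for the metric, the two
  topologies agree everywhere (\<open>L0_topology_eq\<close>), and the metric makes the group of classes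
  completely metrizable.

  The group is quasi non-archimedean by a union bound. Given \<open>n\<close>, \<open>U\<close> and \<open>\<epsilon>\<close>, choose an open
  \<open>U0\<close> such that any \<open>n\<close> elements of \<open>U0\<close> generate a subgroup inside \<open>U\<close>. If each of
  \<open>f\<^sub>1, \<dots>, f\<^sub>n\<close> leaves \<open>U0\<close> only on a set of measure below \<open>\<epsilon> / (n + 1)\<close>, then off a set of
  measure below \<open>\<epsilon>\<close> all of their values lie in \<open>U0\<close>, and there every word in the \<open>f\<^sub>i\<close> takes
  its value in \<open>U\<close>; this exceptional set does not depend on the word.

  For the embedding take the unit interval with Lebesgue measure. Constant maps embed \<open>G\<close>
  isometrically. The group is connected because \<open>f\<close> and \<open>g\<close> are joined by the path of maps equal
  to \<open>f\<close> on \<open>[0, t]\<close> and to \<open>g\<close> on \<open>(t, 1]\<close>. It is separable because a measurable map is close to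
  one with values in a countable dense set, and the measurable index of those values is an almost
  everywhere limit of step functions on uniform partitions.
\<close>

section \<open>Sequences, Borel maps and separable metric spaces\<close>

lemma tendsto_subsubseq_real:
  fixes X :: "nat \<Rightarrow> real"
  assumes "\<And>r :: nat \<Rightarrow> nat. strict_mono r \<Longrightarrow> \<exists>s :: nat \<Rightarrow> nat. strict_mono s \<and> (\<lambda>n. X (r (s n))) \<longlonglongrightarrow> L"
  shows "X \<longlonglongrightarrow> L"
proof (rule ccontr)
  assume "\<not> X \<longlonglongrightarrow> L"
  then obtain \<epsilon> where "\<epsilon> > 0" and "\<not> eventually (\<lambda>n. dist (X n) L < \<epsilon>) sequentially"
    by (auto simp: tendsto_iff)
  then have "infinite {n. \<not> dist (X n) L < \<epsilon>}"
    by (simp add: frequently_def[symmetric] frequently_cofinite[symmetric]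
        cofinite_eq_sequentially not_eventually)
  then obtain r :: "nat \<Rightarrow> nat" where r: "strict_mono r" "\<And>n. \<not> dist (X (r n)) L < \<epsilon>"
    by (metis (no_types, lifting) infinite_enumerate mem_Collect_eq)
  from assms[OF r(1)] obtain s where "(\<lambda>n. X (r (s n))) \<longlonglongrightarrow> L" by blast
  with \<open>\<epsilon> > 0\<close> have "eventually (\<lambda>n. dist (X (r (s n))) L < \<epsilon>) sequentially"
    by (auto simp: tendsto_iff)
  with r(2) show False by simp
qed

lemma space_borel_of [simp]: "space (borel_of T) = topspace T"
  by (simp add: borel_of_def space_measure_of_conv)

lemma sets_borel_of: "sets (borel_of T) = sigma_sets (topspace T) {U. openin T U}"
  unfolding borel_of_def by (rule sets_measure_of) (auto dest: openin_subset)

lemma measurable_borel_ofI: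
  assumes "f \<in> space M \<rightarrow> topspace T"
    and "\<And>U. openin T U \<Longrightarrow> f -` U \<inter> space M \<in> sets M"
  shows "f \<in> measurable M (borel_of T)"
  unfolding borel_of_def using assms
  by (intro measurable_measure_of) (auto dest: openin_subset)

lemma measurable_borel_of_const:
  "a \<in> topspace T \<Longrightarrow> (\<lambda>x. a) \<in> measurable M (borel_of T)"
  by (simp add: measurable_const)

lemma measurable_borel_of_continuous_map:
  assumes f: "f \<in> measurable M (borel_of T)" and h: "continuous_map T T' h"
  shows "(\<lambda>x. h (f x)) \<in> measurable M (borel_of T')"
proof (rule measurable_borel_ofI)
  have fT: "f x \<in> topspace T" if "x \<in> space M" for x
    using measurable_space[OF f that] by simp
  then show "(\<lambda>x. h (f x)) \<in> space M \<rightarrow> topspace T'"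
    using h by (auto simp: continuous_map_def)
  fix U assume "openin T' U"
  then have "openin T {x \<in> topspace T. h x \<in> U}"
    using h by (simp add: continuous_map_def)
  then have "f -` {x \<in> topspace T. h x \<in> U} \<inter> space M \<in> sets M"
    by (intro measurable_sets[OF f] openin_borel_of)
  moreover have "f -` {x \<in> topspace T. h x \<in> U} \<inter> space M = (\<lambda>x. h (f x)) -` U \<inter> space M"
    using fT by auto
  ultimately show "(\<lambda>x. h (f x)) -` U \<inter> space M \<in> sets M" by simp
qed

text \<open>
  Second countability makes an open set of the product a countable union of open rectangles.
\<close>

lemma measurable_borel_of_Pair:
  assumes sc: "second_countable T"
    and f: "f \<in> measurable M (borel_of T)" and g: "g \<in> measurable M (borel_of T)"
  shows "(\<lambda>x. (f x, g x)) \<in> measurable M (borel_of (prod_topology T T))"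
proof (rule measurable_borel_ofI)
  show "(\<lambda>x. (f x, g x)) \<in> space M \<rightarrow> topspace (prod_topology T T)"
    using measurable_space[OF f] measurable_space[OF g] by auto
  fix U assume U: "openin (prod_topology T T) U"
  obtain \<B> where \<B>: "countable \<B>" "\<forall>V\<in>\<B>. openin T V"
    and base: "\<forall>U x. openin T U \<and> x \<in> U \<longrightarrow> (\<exists>V\<in>\<B>. x \<in> V \<and> V \<subseteq> U)"
    using sc unfolding second_countable_def by (elim exE conjE)
  define \<C> where "\<C> = {p \<in> \<B> \<times> \<B>. fst p \<times> snd p \<subseteq> U}"
  have cov: "\<exists>p\<in>\<C>. a \<in> fst p \<and> b \<in> snd p" if uv: "(a, b) \<in> U" for a b
  proof -
    obtain V W where "openin T V" "openin T W" "a \<in> V" "b \<in> W" and VW: "V \<times> W \<subseteq> U"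
      using U[unfolded openin_prod_topology_alt, rule_format, OF uv] by (elim exE conjE)
    obtain V' where V': "V' \<in> \<B>" "a \<in> V'" "V' \<subseteq> V"
      using base[rule_format, of V a] \<open>openin T V\<close> \<open>a \<in> V\<close> by auto
    obtain W' where W': "W' \<in> \<B>" "b \<in> W'" "W' \<subseteq> W"
      using base[rule_format, of W b] \<open>openin T W\<close> \<open>b \<in> W\<close> by auto
    show ?thesis using VW V' W' unfolding \<C>_def by (intro bexI[of _ "(V', W')"]) auto
  qed
  have "(\<lambda>x. (f x, g x)) -` U \<inter> space M
      = (\<Union>p\<in>\<C>. (f -` fst p \<inter> space M) \<inter> (g -` snd p \<inter> space M))"
  proof (rule subset_antisym; rule subsetI)
    fix x assume "x \<in> (\<lambda>x. (f x, g x)) -` U \<inter> space M"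
    then show "x \<in> (\<Union>p\<in>\<C>. (f -` fst p \<inter> space M) \<inter> (g -` snd p \<inter> space M))"
      using cov[of "f x" "g x"] by auto
  next
    fix x assume "x \<in> (\<Union>p\<in>\<C>. (f -` fst p \<inter> space M) \<inter> (g -` snd p \<inter> space M))"
    then obtain p where "p \<in> \<C>" "f x \<in> fst p" "g x \<in> snd p" "x \<in> space M" by blast
    then show "x \<in> (\<lambda>x. (f x, g x)) -` U \<inter> space M"
      unfolding \<C>_def by auto
  qed
  also have "\<dots> \<in> sets M"
  proof (rule sets.countable_UN'')
    show "countable \<C>"
      unfolding \<C>_def using \<B>(1) by (auto intro: countable_subset[of _ "\<B> \<times> \<B>"])
    fix p assume "p \<in> \<C>"
    then have "openin T (fst p)" "openin T (snd p)" using \<B>(2) by (auto simp: \<C>_def)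
    then show "(f -` fst p \<inter> space M) \<inter> (g -` snd p \<inter> space M) \<in> sets M"
      by (intro sets.Int measurable_sets[OF f] measurable_sets[OF g] openin_borel_of)
  qed
  finally show "(\<lambda>x. (f x, g x)) -` U \<inter> space M \<in> sets M" .
qed

lemma (in Metric_space) separable_space_countable_mball_base:
  assumes "separable_space mtopology"
  shows "\<exists>I. countable I \<and> I \<subseteq> M \<times> UNIV \<and>
    (\<forall>U x. openin mtopology U \<longrightarrow> x \<in> U \<longrightarrow> (\<exists>(q, r)\<in>I. x \<in> mball q r \<and> mball q r \<subseteq> U))"
proof -
  obtain Q where Q: "countable Q" "Q \<subseteq> M" "mtopology closure_of Q = M"
    using assms by (auto simp: separable_space_def)
  have "\<exists>(q, r)\<in>Q \<times> \<rat>. x \<in> mball q r \<and> mball q r \<subseteq> U"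
    if U: "openin mtopology U" "x \<in> U" for U x
  proof -
    obtain e where e: "e > 0" "mball x e \<subseteq> U" and x: "x \<in> M"
      using U unfolding openin_mtopology by blast
    obtain r where r: "r \<in> \<rat>" "e / 4 < r" "r < e / 2"
      using Rats_dense_in_real[of "e/4" "e/2"] e(1) by auto
    have "x \<in> mtopology closure_of Q" using Q(3) x by simp
    moreover have "r > 0" using r e by linarith
    ultimately obtain q where q: "q \<in> Q" "q \<in> M" "d x q < r"
      by (auto simp: metric_closure_of)
    have "mball q r \<subseteq> mball x e"
      using q r by (intro mball_subset) (auto simp: x commute[of q x])
    then have "x \<in> mball q r \<and> mball q r \<subseteq> U"
      using q x e(2) by (simp add: commute[of q x])
    then show ?thesis
      using q(1) r(1) by (intro bexI[of _ "(q, r)"]) simp_all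
  qed
  moreover have "countable (Q \<times> (\<rat> :: real set))" using Q(1) by (intro countable_SIGMA countable_rat)
  moreover have "Q \<times> (\<rat> :: real set) \<subseteq> M \<times> UNIV" using Q(2) by auto
  ultimately show ?thesis by (intro exI[of _ "Q \<times> \<rat>"] conjI allI impI)
qed

lemma (in Metric_space) second_countable_of_separable:
  assumes "separable_space mtopology"
  shows "second_countable mtopology"
proof -
  obtain I where I: "countable I"
    "\<forall>U x. openin mtopology U \<longrightarrow> x \<in> U \<longrightarrow> (\<exists>(q, r)\<in>I. x \<in> mball q r \<and> mball q r \<subseteq> U)"
    using separable_space_countable_mball_base[OF assms] by (elim exE conjE)
  show ?thesis unfolding second_countable_def
  proof (intro exI[of _ "(\<lambda>(q, r). mball q r) ` I"] conjI ballI allI impI)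
    show "countable ((\<lambda>(q, r). mball q r) ` I)" using I(1) by simp
    show "openin mtopology V" if "V \<in> (\<lambda>(q, r). mball q r) ` I" for V using that by auto
    show "\<exists>V\<in>(\<lambda>(q, r). mball q r) ` I. x \<in> V \<and> V \<subseteq> U" if "openin mtopology U \<and> x \<in> U" for U x
    proof -
      obtain p where "p \<in> I" "x \<in> (case p of (q, r) \<Rightarrow> mball q r)" "(case p of (q, r) \<Rightarrow> mball q r) \<subseteq> U"
        using I(2)[rule_format, of U x] \<open>openin mtopology U \<and> x \<in> U\<close> by auto
      then show ?thesis by (intro bexI[OF _ imageI]) auto
    qed
  qed
qed

text \<open>The distance between two terms is at most a block of the summable series.\<close>

lemma (in Metric_space) MCauchy_of_summable:
  assumes M: "range a \<subseteq> M" and sum: "summable (\<lambda>k. d (a k) (a (Suc k)))"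
  shows "MCauchy a"
proof -
  have le: "d (a m) (a n) \<le> (\<Sum>k=m..<n. d (a k) (a (Suc k)))" if "m \<le> n" for m n
    using that
  proof (induction n rule: dec_induct)
    case base
    have "a m \<in> M" using M by auto
    then show ?case by simp
  next
    case (step n)
    have "d (a m) (a (Suc n)) \<le> d (a m) (a n) + d (a n) (a (Suc n))"
      using M by (intro triangle) auto
    with step show ?case by simp
  qed
  show ?thesis unfolding MCauchy_def
  proof (intro conjI M allI impI)
    fix \<epsilon> :: real assume "0 < \<epsilon>"
    then obtain N where N: "\<And>m n. m \<ge> N \<Longrightarrow> norm (\<Sum>k=m..<n. d (a k) (a (Suc k))) < \<epsilon>"
      using sum unfolding summable_Cauchy by meson
    have "d (a m) (a n) < \<epsilon>" if "N \<le> m" "m \<le> n" for m n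
      using le[OF that(2)] N[OF that(1), of n] by simp
    then have "d (a m) (a n) < \<epsilon>" if "N \<le> m" "N \<le> n" for m n
      using that commute by (metis nle_le)
    then show "\<exists>N. \<forall>n n'. N \<le> n \<longrightarrow> N \<le> n' \<longrightarrow> d (a n) (a n') < \<epsilon>" by blast
  qed
qed

section \<open>The integral metric on classes of measurable maps\<close>

text \<open>
  The bound on \<open>d\<close> makes every distance function integrable and lets the constant \<open>1\<close> dominate
  in limits under the integral.
\<close>

locale L0_metric = prob_space M + base: Metric_space S d
  for M :: "'x measure" and S :: "'a set" and d :: "'a \<Rightarrow> 'a \<Rightarrow> real" +
  assumes separable: "separable_space base.mtopology"
    and d_le_one: "\<And>a b. d a b \<le> 1"
begin

abbreviation "T \<equiv> base.mtopology"
abbreviation "L \<equiv> measurable M (borel_of T)"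
abbreviation "cl f \<equiv> ae_eq_rel M T `` {f}"
abbreviation "L0 \<equiv> L // ae_eq_rel M T"

definition fdist :: "('x \<Rightarrow> 'a) \<Rightarrow> ('x \<Rightarrow> 'a) \<Rightarrow> real" where
  "fdist f g = (\<integral>x. d (f x) (g x) \<partial>M)"

text \<open>
  The representatives chosen here do not matter, by \<open>L0_dist_cl\<close> below.
\<close>

definition L0_dist :: "('x \<Rightarrow> 'a) set \<Rightarrow> ('x \<Rightarrow> 'a) set \<Rightarrow> real" where
  "L0_dist A B = fdist (SOME f. f \<in> A) (SOME g. g \<in> B)"

lemma fdist_nonneg [simp]: "0 \<le> fdist f g"
  by (simp add: fdist_def)

lemma equiv_ae_eq_rel: "equiv L (ae_eq_rel M T)"
proof (rule equivI)
  show "ae_eq_rel M T \<subseteq> L \<times> L" by (auto simp: ae_eq_rel_def)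
  show "refl_on L (ae_eq_rel M T)" by (auto simp: refl_on_def ae_eq_rel_def)
  show "sym (ae_eq_rel M T)" by (auto simp: sym_def ae_eq_rel_def eq_commute)
  show "trans (ae_eq_rel M T)"
  proof (rule transI)
    fix f g h assume fg: "(f, g) \<in> ae_eq_rel M T" and gh: "(g, h) \<in> ae_eq_rel M T"
    then have "AE x in M. f x = g x" "AE x in M. g x = h x" by (simp_all add: ae_eq_rel_def)
    then have "AE x in M. f x = h x" by eventually_elim simp
    with fg gh show "(f, h) \<in> ae_eq_rel M T" by (simp add: ae_eq_rel_def)
  qed
qed

lemma mem_S: "f \<in> L \<Longrightarrow> x \<in> space M \<Longrightarrow> f x \<in> S"
  using measurable_space[of f M "borel_of T" x] by simp

lemma second_countable: "second_countable T"
  using separable by (rule base.second_countable_of_separable)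

lemma measurable_continuous2:
  assumes "f \<in> L" "g \<in> L" "continuous_map (prod_topology T T) T' (\<lambda>(a, b). \<Phi> a b)"
  shows "(\<lambda>x. \<Phi> (f x) (g x)) \<in> measurable M (borel_of T')"
  using measurable_borel_of_continuous_map[OF
      measurable_borel_of_Pair[OF second_countable assms(1,2)] assms(3)] by simp

lemma borel_of_euclidean: "sets (borel_of euclideanreal) = sets borel"
  by (simp add: sets_borel_of borel_def)

lemma measurable_dist:
  assumes "f \<in> L" "g \<in> L"
  shows "(\<lambda>x. d (f x) (g x)) \<in> borel_measurable M"
proof -
  have "continuous_map (prod_topology T T) euclideanreal (\<lambda>(a, b). d a b)"
    using continuous_map_metric[of base.Self] by (simp add: base.Self_def)
  from measurable_continuous2[OF assms this] show ?thesis
    by (simp cong: measurable_cong_sets add: borel_of_euclidean)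
qed

text \<open>
  Distances to points detect measurability, because open sets are countable unions of balls.
  This reduces measurability of a pointwise limit to the case of real functions.
\<close>

lemma mem_LI:
  assumes f: "\<And>x. x \<in> space M \<Longrightarrow> f x \<in> S"
    and m: "\<And>a. a \<in> S \<Longrightarrow> (\<lambda>x. d (f x) a) \<in> borel_measurable M"
  shows "f \<in> L"
proof (rule measurable_borel_ofI)
  show "f \<in> space M \<rightarrow> topspace T" using f by auto
  fix U assume U: "openin T U"
  obtain I where I: "countable I" "I \<subseteq> S \<times> UNIV"
    and base: "\<forall>U x. openin T U \<longrightarrow> x \<in> U \<longrightarrow>
      (\<exists>(q, r)\<in>I. x \<in> base.mball q r \<and> base.mball q r \<subseteq> U)"
    using base.separable_space_countable_mball_base[OF separable] by (elim exE conjE)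
  define J where "J = {p \<in> I. base.mball (fst p) (snd p) \<subseteq> U}"
  have "f -` U \<inter> space M = (\<Union>p\<in>J. {x \<in> space M. d (f x) (fst p) < snd p})"
  proof (rule subset_antisym; rule subsetI)
    fix x assume x: "x \<in> f -` U \<inter> space M"
    then obtain q r where "(q, r) \<in> I" "f x \<in> base.mball q r" "base.mball q r \<subseteq> U"
      using base[rule_format, OF U, of "f x"] by auto
    then show "x \<in> (\<Union>p\<in>J. {x \<in> space M. d (f x) (fst p) < snd p})"
      using x by (intro UN_I[of "(q, r)"]) (auto simp: J_def base.commute)
  next
    fix x assume "x \<in> (\<Union>p\<in>J. {x \<in> space M. d (f x) (fst p) < snd p})"
    then obtain p where p: "p \<in> J" "x \<in> space M" "d (f x) (fst p) < snd p" by auto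
    then have "f x \<in> base.mball (fst p) (snd p)"
      using f I(2) by (auto simp: J_def base.commute)
    with p show "x \<in> f -` U \<inter> space M" by (auto simp: J_def)
  qed
  also have "\<dots> \<in> sets M"
  proof (rule sets.countable_UN'')
    show "countable J" unfolding J_def using I(1) by (rule countable_subset[rotated]) auto
    fix p assume "p \<in> J"
    then have "(\<lambda>x. d (f x) (fst p)) \<in> borel_measurable M" using I(2) by (auto simp: J_def intro!: m)
    then show "{x \<in> space M. d (f x) (fst p) < snd p} \<in> sets M" by measurable
  qed
  finally show "f -` U \<inter> space M \<in> sets M" .
qed

lemma sets_not_in_open:
  assumes "f \<in> L" "openin T U"
  shows "{x \<in> space M. f x \<notin> U} \<in> sets M"
proof -
  have "space M - (f -` U \<inter> space M) \<in> sets M"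
    using measurable_sets[OF assms(1) openin_borel_of[OF assms(2)]] by blast
  moreover have "space M - (f -` U \<inter> space M) = {x \<in> space M. f x \<notin> U}" by blast
  ultimately show ?thesis by simp
qed

lemma limit_mem_L:
  assumes f: "\<And>n. f n \<in> L"
    and lim: "\<And>x. x \<in> space M \<Longrightarrow> limitin T (\<lambda>n. f n x) (g x) sequentially"
  shows "g \<in> L"
proof (rule mem_LI)
  show gS: "g x \<in> S" if "x \<in> space M" for x using base.limitin_mspace[OF lim[OF that]] .
  fix a assume a: "a \<in> S"
  show "(\<lambda>x. d (g x) a) \<in> borel_measurable M"
  proof (rule borel_measurable_LIMSEQ_real)
    show "(\<lambda>x. d (f n x) a) \<in> borel_measurable M" for n
      using measurable_dist[OF f measurable_borel_of_const[of a]] a by simp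
    fix x assume x: "x \<in> space M"
    have "norm (d (f n x) a - d (g x) a) \<le> d (f n x) (g x)" for n
      using base.mdist_reverse_triangle[of "f n x" a "g x"] mem_S[OF f x] gS[OF x] a
      by (simp add: base.commute)
    then have "\<forall>\<^sub>F n in sequentially. norm (d (f n x) a - d (g x) a) \<le> d (f n x) (g x)"
      by simp
    moreover have "(\<lambda>n. d (f n x) (g x)) \<longlonglongrightarrow> 0"
      using lim[OF x] unfolding base.limitin_metric_dist_null by blast
    ultimately have "(\<lambda>n. d (f n x) a - d (g x) a) \<longlonglongrightarrow> 0"
      by (rule Lim_null_comparison)
    then show "(\<lambda>n. d (f n x) a) \<longlonglongrightarrow> d (g x) a"
      by (rule LIM_zero_cancel)
  qed
qed

lemma integrable_dist: "f \<in> L \<Longrightarrow> g \<in> L \<Longrightarrow> integrable M (\<lambda>x. d (f x) (g x))"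
  by (rule integrable_const_bound[where B = 1]) (simp_all add: d_le_one measurable_dist)

subsection \<open>Almost everywhere equality and the distance of classes\<close>

lemma cl_in_L0: "f \<in> L \<Longrightarrow> cl f \<in> L0" by (rule quotientI)

lemma L0E: assumes "A \<in> L0" obtains f where "f \<in> L" "A = cl f"
  using assms that by (elim quotientE) blast

lemma mem_L0E:
  assumes "A \<in> L0" "f \<in> A"
  shows "f \<in> L" "A = cl f"
proof -
  show "f \<in> L" using in_quotient_imp_subset[OF equiv_ae_eq_rel assms(1)] assms(2) by blast
  obtain g where "g \<in> L" "A = cl g" using assms(1) by (rule L0E)
  then show "A = cl f"
    using assms(2) equiv_class_eq[OF equiv_ae_eq_rel, of g f] by simp
qed

lemma mem_cl: "f \<in> L \<Longrightarrow> f \<in> cl f" by (auto simp: ae_eq_rel_def)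

lemma cl_eq_iff: "f \<in> L \<Longrightarrow> g \<in> L \<Longrightarrow> cl f = cl g \<longleftrightarrow> (AE x in M. f x = g x)"
  using equiv_ae_eq_rel by (subst eq_equiv_class_iff) (auto simp: ae_eq_rel_def)

lemma L0_dist_cl:
  assumes f: "f \<in> L" and g: "g \<in> L"
  shows "L0_dist (cl f) (cl g) = fdist f g"
proof -
  let ?f = "SOME f'. f' \<in> cl f" and ?g = "SOME g'. g' \<in> cl g"
  have "?f \<in> cl f" using mem_cl[OF f] by (rule someI[where P = "\<lambda>f'. f' \<in> cl f"])
  then have F: "?f \<in> L" "AE x in M. f x = ?f x" unfolding ae_eq_rel_def by blast+
  have "?g \<in> cl g" using mem_cl[OF g] by (rule someI[where P = "\<lambda>g'. g' \<in> cl g"])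
  then have G: "?g \<in> L" "AE x in M. g x = ?g x" unfolding ae_eq_rel_def by blast+
  have "AE x in M. d (?f x) (?g x) = d (f x) (g x)"
    using F(2) G(2) by eventually_elim simp
  then show ?thesis unfolding L0_dist_def fdist_def
    by (intro integral_cong_AE measurable_dist F(1) G(1) f g)
qed

lemma fdist_zero_iff:
  assumes "f \<in> L" "g \<in> L" shows "fdist f g = 0 \<longleftrightarrow> (AE x in M. f x = g x)"
proof -
  have "fdist f g = 0 \<longleftrightarrow> (AE x in M. d (f x) (g x) = 0)"
    unfolding fdist_def by (intro integral_nonneg_eq_0_iff_AE integrable_dist assms) auto
  also have "\<dots> \<longleftrightarrow> (AE x in M. f x = g x)"
    by (intro AE_cong) (use assms mem_S in auto)
  finally show ?thesis .
qed

lemma fdist_triangle: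
  assumes "f \<in> L" "g \<in> L" "h \<in> L"
  shows "fdist f h \<le> fdist f g + fdist g h"
proof -
  have "fdist f h \<le> (\<integral>x. d (f x) (g x) + d (g x) (h x) \<partial>M)"
    unfolding fdist_def using assms mem_S
    by (intro integral_mono integrable_dist Bochner_Integration.integrable_add) (auto intro: base.triangle)
  also have "\<dots> = fdist f g + fdist g h"
    unfolding fdist_def by (intro Bochner_Integration.integral_add integrable_dist assms)
  finally show ?thesis .
qed

sublocale L0: Metric_space L0 L0_dist
proof
  show "0 \<le> L0_dist A B" for A B by (simp add: L0_dist_def fdist_def)
  show "L0_dist A B = L0_dist B A" for A B
    by (simp add: L0_dist_def fdist_def base.commute)
  fix A B assume "A \<in> L0" "B \<in> L0"
  then obtain f g where fg: "f \<in> L" "A = cl f" "g \<in> L" "B = cl g" by (metis L0E)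
  show "L0_dist A B = 0 \<longleftrightarrow> A = B"
    unfolding fg(2,4) by (simp only: L0_dist_cl fdist_zero_iff cl_eq_iff fg(1,3))
  fix C assume "C \<in> L0"
  then obtain h where h: "h \<in> L" "C = cl h" by (rule L0E)
  show "L0_dist A C \<le> L0_dist A B + L0_dist B C"
    unfolding fg(2,4) h(2) using fdist_triangle[OF fg(1,3) h(1)]
    by (simp only: L0_dist_cl fg(1,3) h(1))
qed

subsection \<open>Metric and almost everywhere convergence\<close>

lemma fdist_AE_tendsto:
  assumes f: "\<And>n. f n \<in> L" "g \<in> L" and lim: "AE x in M. (\<lambda>n. d (f n x) (g x)) \<longlonglongrightarrow> 0"
  shows "(\<lambda>n. fdist (f n) g) \<longlonglongrightarrow> 0"
proof -
  have "(\<lambda>n. fdist (f n) g) \<longlonglongrightarrow> (\<integral>x. 0 \<partial>M)"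
    unfolding fdist_def
    by (rule integral_dominated_convergence[where w = "\<lambda>_. 1"])
      (use assms in \<open>auto simp: d_le_one intro: measurable_dist\<close>)
  then show ?thesis by simp
qed

lemma fdist_tendsto_AE_subseq:
  assumes f: "\<And>n. f n \<in> L" "g \<in> L" and lim: "(\<lambda>n. fdist (f n) g) \<longlonglongrightarrow> 0"
  obtains r :: "nat \<Rightarrow> nat" where "strict_mono r" "AE x in M. (\<lambda>n. d (f (r n) x) (g x)) \<longlonglongrightarrow> 0"
  using tendsto_L1_AE_subseq[of M "\<lambda>n x. d (f n x) (g x)"] assms
  by (auto simp: fdist_def integrable_dist)

text \<open>
  Almost everywhere convergence passes through \<open>\<Phi>\<close> pointwise. So every subsequence has a further
  subsequence along which the distances tend to \<open>0\<close>, and this forces the whole sequence to converge.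
\<close>

lemma fdist_tendsto_continuous2:
  assumes \<Phi>: "continuous_map (prod_topology T T) T (\<lambda>(a, b). \<Phi> a b)"
    and L: "\<And>n. f n \<in> L" "f' \<in> L" "\<And>n. g n \<in> L" "g' \<in> L"
    and lf: "(\<lambda>n. fdist (f n) f') \<longlonglongrightarrow> 0" and lg: "(\<lambda>n. fdist (g n) g') \<longlonglongrightarrow> 0"
  shows "(\<lambda>n. fdist (\<lambda>x. \<Phi> (f n x) (g n x)) (\<lambda>x. \<Phi> (f' x) (g' x))) \<longlonglongrightarrow> 0"
proof (rule tendsto_subsubseq_real)
  fix r :: "nat \<Rightarrow> nat" assume r: "strict_mono r"
  obtain s where s: "strict_mono s" "AE x in M. (\<lambda>n. d (f (r (s n)) x) (f' x)) \<longlonglongrightarrow> 0"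
    using fdist_tendsto_AE_subseq[of "\<lambda>n. f (r n)" f'] L LIMSEQ_subseq_LIMSEQ[OF lf r]
    by (auto simp: o_def)
  obtain t where t: "strict_mono t" "AE x in M. (\<lambda>n. d (g (r (s (t n))) x) (g' x)) \<longlonglongrightarrow> 0"
    using fdist_tendsto_AE_subseq[of "\<lambda>n. g (r (s n))" g'] L
      LIMSEQ_subseq_LIMSEQ[OF lg strict_mono_o[OF r s(1)]]
    by (auto simp: o_def)
  have "AE x in M. (\<lambda>n. d (\<Phi> (f (r (s (t n))) x) (g (r (s (t n))) x)) (\<Phi> (f' x) (g' x))) \<longlonglongrightarrow> 0"
    using s(2) t(2) AE_space
  proof eventually_elim
    fix x assume lim: "(\<lambda>n. d (f (r (s n)) x) (f' x)) \<longlonglongrightarrow> 0"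
      "(\<lambda>n. d (g (r (s (t n))) x) (g' x)) \<longlonglongrightarrow> 0" and x: "x \<in> space M"
    note m = mem_S[OF L(1) x] mem_S[OF L(2) x] mem_S[OF L(3) x] mem_S[OF L(4) x]
    have "limitin T (\<lambda>n. f (r (s (t n))) x) (f' x) sequentially"
      using LIMSEQ_subseq_LIMSEQ[OF lim(1) t(1)] m
      by (simp add: base.limitin_metric_dist_null o_def)
    moreover have "limitin T (\<lambda>n. g (r (s (t n))) x) (g' x) sequentially"
      using lim(2) m by (simp add: base.limitin_metric_dist_null)
    ultimately have "limitin (prod_topology T T) (\<lambda>n. (f (r (s (t n))) x, g (r (s (t n))) x))
        (f' x, g' x) sequentially"
      by (simp add: limitin_pairwise o_def)
    from continuous_map_limit[OF \<Phi> this]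
    show "(\<lambda>n. d (\<Phi> (f (r (s (t n))) x) (g (r (s (t n))) x)) (\<Phi> (f' x) (g' x))) \<longlonglongrightarrow> 0"
      by (simp add: base.limitin_metric_dist_null o_def)
  qed
  then have "(\<lambda>n. fdist (\<lambda>x. \<Phi> (f (r (s (t n))) x) (g (r (s (t n))) x)) (\<lambda>x. \<Phi> (f' x) (g' x))) \<longlonglongrightarrow> 0"
    by (intro fdist_AE_tendsto measurable_continuous2[OF _ _ \<Phi>] L)
  then show "\<exists>s. strict_mono s \<and> (\<lambda>n. fdist (\<lambda>x. \<Phi> (f (r (s n)) x) (g (r (s n)) x)) (\<lambda>x. \<Phi> (f' x) (g' x))) \<longlonglongrightarrow> 0"
    using strict_mono_o[OF s(1) t(1)] by (intro exI[of _ "\<lambda>n. s (t n)"]) (auto simp: o_def)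
qed

text \<open>
  The operation \<open>F\<close> on classes is whatever \<open>\<Phi>\<close> induces; this is used for multiplication and,
  with \<open>\<Phi>\<close> ignoring its second argument, for inversion.
\<close>

lemma continuous_map_L0:
  assumes \<Phi>: "continuous_map (prod_topology T T) T (\<lambda>(a, b). \<Phi> a b)"
    and F: "\<And>f g. f \<in> L \<Longrightarrow> g \<in> L \<Longrightarrow> F (cl f) (cl g) = cl (\<lambda>x. \<Phi> (f x) (g x))"
  shows "continuous_map (prod_topology L0.mtopology L0.mtopology) L0.mtopology (\<lambda>(A, B). F A B)"
  unfolding L0.continuous_map_to_metric
proof (intro ballI allI impI)
  fix p and \<epsilon> :: real
  assume "p \<in> topspace (prod_topology L0.mtopology L0.mtopology)" and \<epsilon>: "0 < \<epsilon>"
  then obtain A B where p: "p = (A, B)" "A \<in> L0" "B \<in> L0" by auto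
  obtain f where f: "f \<in> L" "A = cl f" using p(2) by (rule L0E)
  obtain g where g: "g \<in> L" "B = cl g" using p(3) by (rule L0E)
  note \<Phi>L = measurable_continuous2[OF _ _ \<Phi>]
  have "\<exists>\<delta>>0. \<forall>f'\<in>L. \<forall>g'\<in>L. fdist f' f < \<delta> \<longrightarrow> fdist g' g < \<delta> \<longrightarrow>
      fdist (\<lambda>x. \<Phi> (f' x) (g' x)) (\<lambda>x. \<Phi> (f x) (g x)) < \<epsilon>"
  proof (rule ccontr)
    assume neg: "\<not> ?thesis"
    define bad where "bad n f' g' \<longleftrightarrow> f' \<in> L \<and> g' \<in> L \<and>
        fdist f' f < 1 / real (Suc n) \<and> fdist g' g < 1 / real (Suc n) \<and>
        \<not> fdist (\<lambda>x. \<Phi> (f' x) (g' x)) (\<lambda>x. \<Phi> (f x) (g x)) < \<epsilon>" for n f' g'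
    have "\<exists>f' g'. bad n f' g'" for n
    proof -
      have "0 < 1 / real (Suc n)" by simp
      with neg show ?thesis unfolding bad_def by blast
    qed
    then obtain f' g' where bad: "\<And>n. bad n (f' n) (g' n)" by metis
    have fg: "f' n \<in> L" "g' n \<in> L" "fdist (f' n) f < 1 / real (Suc n)" "fdist (g' n) g < 1 / real (Suc n)"
      and far: "\<not> fdist (\<lambda>x. \<Phi> (f' n x) (g' n x)) (\<lambda>x. \<Phi> (f x) (g x)) < \<epsilon>" for n
      using bad[of n] unfolding bad_def by blast+
    have "(\<lambda>n. fdist (f' n) f) \<longlonglongrightarrow> 0"
      by (rule LIMSEQ_norm_0) (simp only: real_norm_def abs_of_nonneg[OF fdist_nonneg] fg(3))
    moreover have "(\<lambda>n. fdist (g' n) g) \<longlonglongrightarrow> 0"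
      by (rule LIMSEQ_norm_0) (simp only: real_norm_def abs_of_nonneg[OF fdist_nonneg] fg(4))
    ultimately have "(\<lambda>n. fdist (\<lambda>x. \<Phi> (f' n x) (g' n x)) (\<lambda>x. \<Phi> (f x) (g x))) \<longlonglongrightarrow> 0"
      by (intro fdist_tendsto_continuous2[OF \<Phi>] fg(1,2) f(1) g(1))
    then have "\<forall>\<^sub>F n in sequentially. fdist (\<lambda>x. \<Phi> (f' n x) (g' n x)) (\<lambda>x. \<Phi> (f x) (g x)) < \<epsilon>"
      using \<epsilon> by (rule order_tendstoD)
    with far show False by simp
  qed
  then obtain \<delta> where \<delta>: "\<delta> > 0" and close: "\<And>f' g'. f' \<in> L \<Longrightarrow> g' \<in> L \<Longrightarrow> fdist f' f < \<delta> \<Longrightarrow>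
      fdist g' g < \<delta> \<Longrightarrow> fdist (\<lambda>x. \<Phi> (f' x) (g' x)) (\<lambda>x. \<Phi> (f x) (g x)) < \<epsilon>"
    by metis
  show "\<exists>U. openin (prod_topology L0.mtopology L0.mtopology) U \<and> p \<in> U \<and>
      (\<forall>q\<in>U. (case q of (A, B) \<Rightarrow> F A B) \<in> L0.mball (case p of (A, B) \<Rightarrow> F A B) \<epsilon>)"
  proof (intro exI[of _ "L0.mball A \<delta> \<times> L0.mball B \<delta>"] conjI ballI)
    show "openin (prod_topology L0.mtopology L0.mtopology) (L0.mball A \<delta> \<times> L0.mball B \<delta>)"
      by (simp add: openin_prod_Times_iff)
    show "p \<in> L0.mball A \<delta> \<times> L0.mball B \<delta>" using p \<delta> by simp
    fix q assume "q \<in> L0.mball A \<delta> \<times> L0.mball B \<delta>"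
    then obtain A' B' where q: "q = (A', B')" "A' \<in> L0" "B' \<in> L0" "L0_dist A A' < \<delta>" "L0_dist B B' < \<delta>"
      by auto
    obtain f' where f': "f' \<in> L" "A' = cl f'" using q(2) by (rule L0E)
    obtain g' where g': "g' \<in> L" "B' = cl g'" using q(3) by (rule L0E)
    have "fdist f' f < \<delta>" "fdist g' g < \<delta>"
      using q(4,5) unfolding f'(2) g'(2) f(2) g(2) L0.commute[of "cl f"] L0.commute[of "cl g"]
      by (simp_all only: L0_dist_cl f(1) g(1) f'(1) g'(1))
    then have "fdist (\<lambda>x. \<Phi> (f' x) (g' x)) (\<lambda>x. \<Phi> (f x) (g x)) < \<epsilon>"
      by (intro close f'(1) g'(1))
    then have "L0_dist (F A B) (F A' B') < \<epsilon>"
      unfolding f(2) g(2) f'(2) g'(2) F[OF f(1) g(1)] F[OF f'(1) g'(1)] L0.commute[of "cl (\<lambda>x. \<Phi> (f x) (g x))"]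
      by (simp only: L0_dist_cl \<Phi>L f(1) g(1) f'(1) g'(1))
    moreover have "F A B \<in> L0" "F A' B' \<in> L0"
      unfolding f(2) g(2) f'(2) g'(2) F[OF f(1) g(1)] F[OF f'(1) g'(1)]
      by (intro cl_in_L0 \<Phi>L f(1) g(1) f'(1) g'(1))+
    ultimately show "(case q of (A, B) \<Rightarrow> F A B) \<in> L0.mball (case p of (A, B) \<Rightarrow> F A B) \<epsilon>"
      by (simp add: p(1) q(1))
  qed
qed

subsection \<open>Completeness and separability\<close>

text \<open>
  As in the Riesz--Fischer theorem: a subsequence with distances at most \<open>(1/2)^k\<close> has almost
  everywhere summable pointwise distances, hence is almost everywhere Cauchy in \<open>S\<close>, and its
  pointwise limit is the limit in the metric.
\<close>

lemma mcomplete_L0: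
  assumes complete: "base.mcomplete"
  shows "L0.mcomplete"
  unfolding L0.mcomplete_def
proof (intro allI impI)
  fix \<sigma> assume C: "L0.MCauchy \<sigma>"
  then have "\<sigma> n \<in> L0" for n by (auto simp: L0.MCauchy_def)
  then have "\<exists>f. f \<in> L \<and> \<sigma> n = cl f" for n by (metis L0E)
  then obtain f where f: "\<And>n. f n \<in> L" and \<sigma>: "\<And>n. \<sigma> n = cl (f n)" by metis
  have "\<exists>N. \<forall>n n'. N \<le> n \<longrightarrow> N \<le> n' \<longrightarrow> fdist (f n) (f n') < (1/2) ^ k" for k :: nat
  proof -
    have "(0::real) < (1/2) ^ k" by simp
    then have "\<exists>N. \<forall>n n'. N \<le> n \<longrightarrow> N \<le> n' \<longrightarrow> L0_dist (\<sigma> n) (\<sigma> n') < (1/2) ^ k"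
      using C unfolding L0.MCauchy_def by blast
    then show ?thesis by (simp only: \<sigma> L0_dist_cl f)
  qed
  then obtain N where N: "\<And>k n n'. N k \<le> n \<Longrightarrow> N k \<le> n' \<Longrightarrow> fdist (f n) (f n') < (1/2) ^ k"
    by metis
  \<comment> \<open>Partial sums dominate each \<open>N k\<close> and are strictly increasing.\<close>
  define r where "r k = (\<Sum>i\<le>k. Suc (N i))" for k
  have r: "strict_mono r" by (simp add: strict_mono_Suc_iff r_def)
  have rN: "N k \<le> r k" for k
    unfolding r_def by (cases k) auto
  define D where "D k x = d (f (r k) x) (f (r (Suc k)) x)" for k x
  have D_int: "integrable M (D k)" for k unfolding D_def by (intro integrable_dist f)
  have "fdist (f (r k)) (f (r (Suc k))) < (1/2) ^ k" for k
    using strict_monoD[OF r, of k "Suc k"] rN[of k] by (intro N) auto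
  then have small: "(\<integral>x. D k x \<partial>M) \<le> (1/2) ^ k" for k
    unfolding D_def fdist_def by (simp add: less_imp_le)
  have "(\<integral>\<^sup>+ x. (\<Sum>k. ennreal (D k x)) \<partial>M) = (\<Sum>k. \<integral>\<^sup>+ x. ennreal (D k x) \<partial>M)"
    using D_int by (intro nn_integral_suminf) auto
  also have "\<dots> = (\<Sum>k. ennreal (\<integral>x. D k x \<partial>M))"
    by (intro suminf_cong nn_integral_eq_integral D_int) (simp add: D_def)
  also have "\<dots> \<le> (\<Sum>k. ennreal ((1/2) ^ k))"
    by (intro suminf_le summableI ennreal_leI small)
  also have "\<dots> = ennreal (\<Sum>k. (1/2) ^ k)"
    by (intro suminf_ennreal2) (auto intro: summable_geometric)
  finally have "(\<integral>\<^sup>+ x. (\<Sum>k. ennreal (D k x)) \<partial>M) \<noteq> \<infinity>"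
    by (auto simp: top_unique)
  then have "AE x in M. (\<Sum>k. ennreal (D k x)) \<noteq> \<infinity>"
    using D_int by (intro nn_integral_PInf_AE) auto
  then have "AE x in M. \<exists>l. limitin T (\<lambda>k. f (r k) x) l sequentially"
    using AE_space
  proof eventually_elim
    fix x assume "(\<Sum>k. ennreal (D k x)) \<noteq> \<infinity>" and x: "x \<in> space M"
    then have "summable (\<lambda>k. D k x)"
      by (intro summable_suminf_not_top) (auto simp: D_def)
    then have "base.MCauchy (\<lambda>k. f (r k) x)"
      unfolding D_def using mem_S[OF f x] by (intro base.MCauchy_of_summable) auto
    then show "\<exists>l. limitin T (\<lambda>k. f (r k) x) l sequentially"
      using complete by (simp add: base.mcomplete_def)
  qed
  then obtain Z where "{x \<in> space M. \<not> (\<exists>l. limitin T (\<lambda>k. f (r k) x) l sequentially)} \<subseteq> Z"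
    and null: "Z \<in> null_sets M"
    by (auto elim!: AE_E simp: null_sets_def)
  then have Z: "\<exists>l. limitin T (\<lambda>k. f (r k) x) l sequentially" if "x \<in> space M" "x \<notin> Z" for x
    using that by blast
  \<comment> \<open>On the null set \<open>Z\<close> the value \<open>f 0 x\<close> is used, so that convergence holds at every point.\<close>
  define h where "h k x = (if x \<in> Z then f 0 x else f (r k) x)" for k x
  define g where "g x = (if x \<in> Z then f 0 x else SOME l. limitin T (\<lambda>k. f (r k) x) l sequentially)" for x
  have lim: "limitin T (\<lambda>k. h k x) (g x) sequentially" if "x \<in> space M" for x
  proof (cases "x \<in> Z")
    case True
    then show ?thesis using mem_S[OF f that] by (simp add: h_def g_def limitin_const_iff)
  next
    case False
    then show ?thesis using someI_ex[OF Z[of x]] that by (simp add: h_def g_def)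
  qed
  have "h k \<in> L" for k
    unfolding h_def using null f by (intro measurable_If_set) auto
  then have g: "g \<in> L" using lim by (rule limit_mem_L)
  have "AE x in M. (\<lambda>k. d (f (r k) x) (g x)) \<longlonglongrightarrow> 0"
    using AE_not_in[OF null] AE_space
  proof eventually_elim
    fix x assume "x \<notin> Z" "x \<in> space M"
    then show "(\<lambda>k. d (f (r k) x) (g x)) \<longlonglongrightarrow> 0"
      using lim[of x] by (simp add: h_def base.limitin_metric_dist_null)
  qed
  then have "(\<lambda>k. fdist (f (r k)) g) \<longlonglongrightarrow> 0" by (intro fdist_AE_tendsto f g)
  then have "limitin L0.mtopology (\<sigma> \<circ> r) (cl g) sequentially"
    unfolding L0.limitin_metric_dist_null
    by (simp add: \<sigma> L0_dist_cl f g cl_in_L0)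
  then show "\<exists>A. limitin L0.mtopology \<sigma> A sequentially"
    using L0.MCauchy_convergent_subsequence[OF C r] by blast
qed

lemma fdist_const: "fdist (\<lambda>_. a) (\<lambda>_. b) = d a b"
  by (simp add: fdist_def prob_space)

lemma embedding_map_const: "embedding_map T L0.mtopology (\<lambda>a. cl (\<lambda>_. a))"
proof -
  interpret M12: Metric_space12 S d L0 L0_dist ..
  show ?thesis
  proof (rule M12.isometry_imp_embedding_map)
    show "(\<lambda>a. cl (\<lambda>_. a)) \<in> S \<rightarrow> L0"
      by (intro funcsetI cl_in_L0 measurable_borel_of_const) simp
    show "L0_dist (cl (\<lambda>_. a)) (cl (\<lambda>_. b)) = d a b" if "a \<in> S" "b \<in> S" for a b
      using that by (subst L0_dist_cl) (simp_all add: measurable_borel_of_const fdist_const)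
  qed
qed

text \<open>
  For \<open>q\<close> enumerating a dense sequence of \<open>S\<close>, every measurable map is uniformly close to some
  \<open>q \<circ> n\<close> with \<open>n\<close> measurable into the naturals. It remains to approximate \<open>n\<close>: since the values are
  discrete, the hypothesis \<open>approx\<close> is almost everywhere convergence, and it is inherited by \<open>q \<circ> n\<close>.
\<close>

lemma separable_L0:
  assumes ne: "S \<noteq> {}"
    and E: "countable E" "\<And>e. e \<in> E \<Longrightarrow> e \<in> measurable M (count_space (UNIV :: nat set))"
    and approx: "\<And>n. n \<in> measurable M (count_space (UNIV :: nat set)) \<Longrightarrow>
      \<exists>e. (\<forall>j::nat. e j \<in> E) \<and> (AE x in M. \<forall>\<^sub>F j in sequentially. e j x = n x)"
  shows "separable_space L0.mtopology"
proof -
  obtain Q where Q: "countable Q" "Q \<subseteq> S" "T closure_of Q = S"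
    using separable by (auto simp: separable_space_def)
  have "Q \<noteq> {}" using Q(3) ne by auto
  define q where "q = from_nat_into Q"
  have qS: "q k \<in> S" for k unfolding q_def using from_nat_into[OF \<open>Q \<noteq> {}\<close>] Q(2) by blast
  have comp: "(\<lambda>x. q (n x)) \<in> L" if "n \<in> measurable M (count_space UNIV)" for n
    using that by (rule measurable_compose) (simp add: qS)
  define C where "C = (\<lambda>e. cl (\<lambda>x. q (e x))) ` E"
  have "\<exists>B\<in>C. B \<in> L0.mball A \<epsilon>" if A: "A \<in> L0" and \<epsilon>: "\<epsilon> > 0" for A \<epsilon>
  proof -
    obtain f where f: "f \<in> L" "A = cl f" using A by (rule L0E)
    define n where "n x = (LEAST k. d (f x) (q k) < \<epsilon> / 2)" for x
    have ex: "\<exists>k. d (f x) (q k) < \<epsilon> / 2" if x: "x \<in> space M" for x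
    proof -
      have "f x \<in> T closure_of Q" using mem_S[OF f(1) x] Q(3) by simp
      then obtain y where "y \<in> Q" "d (f x) y < \<epsilon> / 2"
        using \<epsilon> unfolding base.metric_closure_of by (auto dest: spec[of _ "\<epsilon>/2"])
      then show ?thesis
        unfolding q_def by (metis from_nat_into_surj Q(1))
    qed
    have n_close: "d (f x) (q (n x)) < \<epsilon> / 2" if "x \<in> space M" for x
      unfolding n_def using ex[OF that] by (rule LeastI_ex)
    have [measurable]: "(\<lambda>x. d (f x) (q k)) \<in> borel_measurable M" for k
      using f(1) by (intro measurable_dist measurable_borel_of_const) (simp_all add: qS)
    have n: "n \<in> measurable M (count_space UNIV)"
      unfolding n_def by measurable
    obtain e where "\<forall>j::nat. e j \<in> E" and e2: "AE x in M. \<forall>\<^sub>F j in sequentially. e j x = n x"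
      using approx[OF n] by (elim exE conjE)
    then have e: "e j \<in> E" for j by simp
    note qe = comp[OF E(2)[OF e]]
    have "(\<lambda>j. fdist (\<lambda>x. q (e j x)) (\<lambda>x. q (n x))) \<longlonglongrightarrow> 0"
    proof (intro fdist_AE_tendsto qe comp[OF n])
      show "AE x in M. (\<lambda>j. d (q (e j x)) (q (n x))) \<longlonglongrightarrow> 0"
        using e2
      proof eventually_elim
        fix x assume "\<forall>\<^sub>F j in sequentially. e j x = n x"
        then have "\<forall>\<^sub>F j in sequentially. d (q (e j x)) (q (n x)) = 0"
          by eventually_elim (simp add: qS)
        then show "(\<lambda>j. d (q (e j x)) (q (n x))) \<longlonglongrightarrow> 0" by (rule tendsto_eventually)
      qed
    qed
    then have "\<forall>\<^sub>F j in sequentially. fdist (\<lambda>x. q (e j x)) (\<lambda>x. q (n x)) < \<epsilon> / 2"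
      using \<epsilon> by (intro order_tendstoD(2)) auto
    then obtain j where j: "fdist (\<lambda>x. q (e j x)) (\<lambda>x. q (n x)) < \<epsilon> / 2"
      by (auto simp: eventually_sequentially)
    have "fdist f (\<lambda>x. q (n x)) \<le> (\<integral>x. \<epsilon> / 2 \<partial>M)"
      unfolding fdist_def
      by (rule integral_mono[OF integrable_dist[OF f(1) comp[OF n]]])
        (simp_all add: less_imp_le[OF n_close] del: less_divide_eq_numeral1 le_divide_eq_numeral1)
    then have "fdist f (\<lambda>x. q (n x)) \<le> \<epsilon> / 2" by (simp add: prob_space)
    moreover have "fdist (\<lambda>x. q (n x)) (\<lambda>x. q (e j x)) < \<epsilon> / 2"
      using j by (simp add: fdist_def base.commute)
    moreover note fdist_triangle[OF f(1) comp[OF n] qe[of j]]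
    ultimately have "L0_dist A (cl (\<lambda>x. q (e j x))) < \<epsilon>"
      unfolding f(2) by (simp add: L0_dist_cl f(1) qe)
    then have "cl (\<lambda>x. q (e j x)) \<in> L0.mball A \<epsilon>" using A cl_in_L0[OF qe] by simp
    then show ?thesis using e by (auto simp: C_def)
  qed
  then have "L0.mtopology closure_of C = L0" unfolding L0.metric_closure_of by auto
  moreover have "countable C" using E(1) by (simp add: C_def)
  moreover have "C \<subseteq> L0" using E(2) by (auto simp: C_def intro: cl_in_L0 comp)
  ultimately show ?thesis unfolding separable_space_def by (intro exI[of _ C]) simp
qed

end

section \<open>Lebesgue measure on the unit interval\<close>

abbreviation unit_interval :: "real measure" where
  "unit_interval \<equiv> restrict_space lborel {0..1}"

lemma prob_space_unit_interval: "prob_space unit_interval"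
  by (intro prob_spaceI) (simp add: emeasure_restrict_space)

text \<open>
  The value on \<open>[i/k, (i+1)/k)\<close> is the \<open>i\<close>-th entry of the list. Beyond the list the value is \<open>0\<close>,
  and encoding by lists of naturals makes the family countable.
\<close>

definition step_fun :: "nat \<Rightarrow> nat list \<Rightarrow> real \<Rightarrow> nat" where
  "step_fun k xs x = (let i = nat \<lfloor>real k * x\<rfloor> in if i < length xs then xs ! i else 0)"

lemma measurable_step_fun: "step_fun k xs \<in> measurable unit_interval (count_space UNIV)"
proof -
  have "(\<lambda>x. nat \<lfloor>real k * x\<rfloor>) \<in> measurable unit_interval (count_space UNIV)"
    by (intro measurable_restrict_space1) measurable
  then show ?thesis
    unfolding step_fun_def Let_def by (rule measurable_compose) simp
qed

text \<open>
  Uniform continuity: \<open>y\<close> is the value of \<open>g\<close> at the left endpoint of the cell of \<open>x\<close>.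
\<close>

lemma continuous_approx_step_fun:
  fixes g :: "real \<Rightarrow> real"
  assumes cont: "continuous_on {0..1} g" and \<delta>: "\<delta> > 0"
  shows "\<exists>k xs. \<forall>x\<in>{0..1}. \<exists>y. \<bar>y - g x\<bar> < \<delta> \<and> step_fun k xs x = nat (round y)"
proof -
  have "uniformly_continuous_on {0..1} g"
    using cont by (rule compact_uniformly_continuous) simp
  then obtain \<eta> where \<eta>: "\<eta> > 0" and close: "\<And>x y. x \<in> {0..1} \<Longrightarrow> y \<in> {0..1} \<Longrightarrow>
      dist y x < \<eta> \<Longrightarrow> dist (g y) (g x) < \<delta>"
    using \<delta> unfolding uniformly_continuous_on_def by metis
  obtain k where k: "inverse (real (Suc k)) < \<eta>" using reals_Archimedean[OF \<eta>] by auto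
  define K where "K = Suc k"
  \<comment> \<open>The list has \<open>K + 1\<close> entries because the point \<open>1\<close> lies in the cell of index \<open>K\<close>.\<close>
  define xs where "xs = map (\<lambda>i. nat (round (g (real i / real K)))) [0..<Suc K]"
  have "\<exists>y. \<bar>y - g x\<bar> < \<delta> \<and> step_fun K xs x = nat (round y)" if x: "x \<in> {0..1}" for x
  proof (intro exI conjI)
    define i where "i = nat \<lfloor>real K * x\<rfloor>"
    have K0: "real K > 0" by (simp add: K_def)
    have "real K * x \<ge> 0" "real K * x \<le> real K"
      using x by (auto simp: mult_left_le)
    then have i: "real i \<le> real K * x" "real K * x < real i + 1"
      unfolding i_def by linarith+
    then have iK: "i \<le> K" using \<open>real K * x \<le> real K\<close> by linarith
    have "real i / real K \<le> x" "x < real i / real K + 1 / real K"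
      using i K0 by (simp_all add: field_simps)
    then have "dist (real i / real K) x < \<eta>"
      using k by (simp add: dist_real_def K_def inverse_eq_divide)
    moreover have "real i / real K \<in> {0..1}" using iK K0 by (simp add: field_simps)
    ultimately show "\<bar>g (real i / real K) - g x\<bar> < \<delta>"
      using close[OF x] by (simp add: dist_real_def)
    have "xs ! i = nat (round (g (real i / real K)))" "i < length xs"
      using iK unfolding xs_def by (simp_all del: upt_Suc)
    then show "step_fun K xs x = nat (round (g (real i / real K)))"
      by (simp add: step_fun_def i_def Let_def)
  qed
  then show ?thesis by blast
qed

lemma AE_unit_interval_of_negligible:
  assumes "negligible N" and "\<And>x. x \<in> {0..1} \<Longrightarrow> x \<notin> N \<Longrightarrow> P x"
  shows "AE x in unit_interval. P x"
proof -
  have "N \<in> null_sets (completion lborel)" using assms(1) by (simp add: negligible_iff_null_sets)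
  then have "AE x in completion lborel. x \<notin> N" by (rule AE_not_in)
  then have "AE x in lborel. x \<notin> N" by (simp add: AE_completion_iff)
  then have "AE x in lborel. x \<in> {0..1} \<longrightarrow> P x" by eventually_elim (use assms(2) in blast)
  then show ?thesis by (subst AE_restrict_space_iff) auto
qed

text \<open>
  A measurable function is an almost everywhere limit of continuous functions \<open>g j\<close>. When the
  limit \<open>n x\<close> is an integer, any \<open>y\<close> within \<open>1/4\<close> of \<open>g j x\<close> rounds to \<open>n x\<close> as soon as \<open>g j x\<close> is
  within \<open>1/4\<close> of \<open>n x\<close>; so a uniform \<open>1/4\<close>-approximation of each \<open>g j\<close> is enough.
\<close>

lemma unit_interval_step_fun_dense:
  assumes n: "n \<in> measurable unit_interval (count_space (UNIV :: nat set))"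
  shows "\<exists>e. (\<forall>j::nat. e j \<in> range (\<lambda>(k, xs). step_fun k xs)) \<and>
    (AE x in unit_interval. \<forall>\<^sub>F j in sequentially. e j x = n x)"
proof -
  define u where "u x = (if x \<in> {0..1} then real (n x) else 0)" for x
  have "(\<lambda>x. real (n x)) \<in> borel_measurable unit_interval"
    using n by (rule measurable_compose) simp
  then have "(\<lambda>x. indicator {0..1} x *\<^sub>R real (n x)) \<in> borel_measurable lborel"
    by (subst (asm) borel_measurable_restrict_space_iff) auto
  moreover have "(\<lambda>x. indicator {0..1} x *\<^sub>R real (n x)) = u"
    by (auto simp: u_def fun_eq_iff)
  ultimately have "u \<in> borel_measurable lborel" by simp
  then have "u \<in> borel_measurable lebesgue" by (rule measurable_completion)
  then have "u measurable_on UNIV" by (rule lebesgue_measurable_imp_measurable_on_real) simp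
  then obtain N g where N: "negligible N" and cont: "\<And>j. continuous_on UNIV (g j)"
    and lim: "\<And>x. x \<notin> N \<Longrightarrow> (\<lambda>j. g j x) \<longlonglongrightarrow> u x"
    unfolding measurable_on_def by auto
  have "\<exists>e. e \<in> range (\<lambda>(k, xs). step_fun k xs) \<and>
      (\<forall>x\<in>{0..1}. \<exists>y. \<bar>y - g j x\<bar> < 1/4 \<and> e x = nat (round y))" for j
  proof -
    have "continuous_on {0..1} (g j)" using cont by (rule continuous_on_subset) simp
    moreover have "(0::real) < 1/4" by simp
    ultimately obtain k xs
      where "\<forall>x\<in>{0..1}. \<exists>y. \<bar>y - g j x\<bar> < 1/4 \<and> step_fun k xs x = nat (round y)"
      using continuous_approx_step_fun by blast
    then show ?thesis by (intro exI[of _ "step_fun k xs"]) auto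
  qed
  then obtain e where e: "\<And>j. e j \<in> range (\<lambda>(k, xs). step_fun k xs)"
    and round: "\<And>j x. x \<in> {0..1} \<Longrightarrow> \<exists>y. \<bar>y - g j x\<bar> < 1/4 \<and> e j x = nat (round y)"
    by metis
  have "AE x in unit_interval. \<forall>\<^sub>F j in sequentially. e j x = n x"
  proof (rule AE_unit_interval_of_negligible[OF N])
    fix x :: real assume x: "x \<in> {0..1}" "x \<notin> N"
    have "\<forall>\<^sub>F j in sequentially. dist (g j x) (u x) < 1/4"
      using lim[OF x(2)] by (rule tendstoD) simp
    then show "\<forall>\<^sub>F j in sequentially. e j x = n x"
    proof eventually_elim
      fix j assume j: "dist (g j x) (u x) < 1/4"
      obtain y where y: "\<bar>y - g j x\<bar> < 1/4" "e j x = nat (round y)" using round[OF x(1)] by blast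
      have "\<bar>g j x - real (n x)\<bar> < 1/4"
        using j x(1) by (simp add: u_def dist_real_def)
      with y(1) have "\<bar>y - real (n x)\<bar> < 1/2" by linarith
      then have "round y = int (n x)" by (intro round_unique') (simp add: abs_minus_commute)
      then show "e j x = n x" using y(2) by simp
    qed
  qed
  with e show ?thesis by blast
qed

locale L0_metric_unit_interval = L0_metric unit_interval S d
  for S :: "'a set" and d :: "'a \<Rightarrow> 'a \<Rightarrow> real"
begin

lemma separable_L0_unit_interval:
  assumes "S \<noteq> {}"
  shows "separable_space L0.mtopology"
proof (rule separable_L0[OF assms])
  show "countable (range (\<lambda>(k, xs). step_fun k xs))" by simp
  show "e \<in> measurable unit_interval (count_space UNIV)" if "e \<in> range (\<lambda>(k, xs). step_fun k xs)" for e
    using that measurable_step_fun by auto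
qed (rule unit_interval_step_fun_dense)

text \<open>
  The splicing path \<open>h\<close> is Lipschitz: \<open>h s\<close> and \<open>h t\<close> differ only between \<open>s\<close> and \<open>t\<close>, where the
  distance is at most \<open>1\<close>. On the interval \<open>h 1 = f\<close>, while \<open>h 0\<close> still takes the value of \<open>f\<close> at
  the point \<open>0\<close>; so \<open>h (-1) = g\<close> serves as the other end.
\<close>

lemma connected_L0_unit_interval: "connected_space L0.mtopology"
  unfolding connected_space_subconnected
proof (intro ballI)
  fix A B assume "A \<in> topspace L0.mtopology" "B \<in> topspace L0.mtopology"
  then have AB: "A \<in> L0" "B \<in> L0" by simp_all
  obtain f where f: "f \<in> L" "A = cl f" using AB(1) by (rule L0E)
  obtain g where g: "g \<in> L" "B = cl g" using AB(2) by (rule L0E)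
  define h where "h t x = (if x \<le> t then f x else g x)" for t x :: real
  have h: "h t \<in> L" for t
    unfolding h_def using f(1) g(1)
    by (rule measurable_If) (auto simp: sets_restrict_space space_restrict_space intro!: image_eqI[of _ _ "{..t}"])
  have le: "fdist (h s) (h t) \<le> t - s" if "s \<le> t" for s t
  proof -
    have I: "{s<..t} \<inter> {0..1} \<in> sets unit_interval"
      by (subst sets_restrict_space_iff) auto
    have "fdist (h s) (h t) \<le> (\<integral>x. indicator ({s<..t} \<inter> {0..1}) x \<partial>unit_interval)"
      unfolding fdist_def
    proof (rule integral_mono[OF integrable_dist[OF h h]])
      show "integrable unit_interval (indicator ({s<..t} \<inter> {0..1}) :: real \<Rightarrow> real)"
        using I by (intro integrable_real_indicator) (simp_all add: emeasure_finite less_top[symmetric])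
      fix x :: real assume x: "x \<in> space unit_interval"
      then have fg: "f x \<in> S" "g x \<in> S" by (rule mem_S[OF f(1)], rule mem_S[OF g(1)])
      show "d (h s x) (h t x) \<le> indicator ({s<..t} \<inter> {0..1}) x"
      proof (cases "s < x \<and> x \<le> t")
        case True
        then show ?thesis using x by (simp add: space_restrict_space d_le_one)
      next
        case False
        then have "h s x = h t x" using that by (auto simp: h_def)
        then show ?thesis using fg by (simp add: h_def)
      qed
    qed
    also have "\<dots> = measure unit_interval ({s<..t} \<inter> {0..1})"
      using I by simp
    also have "\<dots> = measure lborel ({s<..t} \<inter> {0..1})"
      by (rule measure_restrict_space) auto
    also have "\<dots> \<le> measure lborel {s<..t}"
      by (rule measure_mono_fmeasurable) (auto intro!: fmeasurableI simp: that)
    also have "\<dots> = t - s" using that by simp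
    finally show ?thesis .
  qed
  have "continuous_map euclideanreal L0.mtopology (\<lambda>t. cl (h t))"
    unfolding L0.continuous_map_to_metric
  proof (intro ballI allI impI)
    fix t \<epsilon> :: real assume "0 < \<epsilon>"
    have "L0_dist (cl (h t)) (cl (h s)) < \<epsilon>" if "s \<in> ball t \<epsilon>" for s
    proof -
      have "fdist (h t) (h s) \<le> \<bar>t - s\<bar>"
        using le[of s t] le[of t s] by (cases "s \<le> t") (auto simp: fdist_def base.commute)
      then show ?thesis using that by (simp add: L0_dist_cl h dist_real_def)
    qed
    then show "\<exists>U. openin euclideanreal U \<and> t \<in> U \<and> (\<forall>s\<in>U. cl (h s) \<in> L0.mball (cl (h t)) \<epsilon>)"
      using \<open>0 < \<epsilon>\<close> by (intro exI[of _ "ball t \<epsilon>"]) (simp add: cl_in_L0 h)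
  qed
  then have "connectedin L0.mtopology (range (\<lambda>t. cl (h t)))"
    by (rule connectedin_continuous_map_image) (simp add: connected_UNIV)
  moreover have "A = cl (h 1)" unfolding f(2)
    by (subst cl_eq_iff[OF f(1) h]) (auto simp: h_def space_restrict_space intro!: AE_I2)
  moreover have "B = cl (h (-1))" unfolding g(2)
    by (subst cl_eq_iff[OF g(1) h]) (auto simp: h_def space_restrict_space intro!: AE_I2)
  ultimately show "\<exists>C. connectedin L0.mtopology C \<and> A \<in> C \<and> B \<in> C"
    by (intro exI[of _ "range (\<lambda>t. cl (h t))"]) auto
qed

end

section \<open>The topological group of classes\<close>

locale L0_metric_group = L0_metric M S d
  for M :: "'x measure" and S :: "'a set" and d +
  fixes G :: "('a, 'b) monoid_scheme" (structure)
  assumes topological_group: "topological_group G T"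
begin

abbreviation "H \<equiv> L0_group M G T"

sublocale G: group G using topological_group by (simp add: topological_group_def)

lemma carrier_eq: "carrier G = S"
  using topological_group by (simp add: topological_group_def)

lemma mult_continuous: "continuous_map (prod_topology T T) T (\<lambda>(a, b). a \<otimes> b)"
  using topological_group unfolding topological_group_def by blast

lemma inv_continuous: "continuous_map T T (\<lambda>a. inv a)"
  using topological_group unfolding topological_group_def by blast

lemma one_L: "(\<lambda>_. \<one>) \<in> L"
  by (rule measurable_borel_of_const) (use G.one_closed carrier_eq in simp)

lemma mult_L: "f \<in> L \<Longrightarrow> g \<in> L \<Longrightarrow> (\<lambda>x. f x \<otimes> g x) \<in> L"
  by (rule measurable_continuous2[OF _ _ mult_continuous])

lemma inv_L: "f \<in> L \<Longrightarrow> (\<lambda>x. inv (f x)) \<in> L"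
  by (rule measurable_borel_of_continuous_map[OF _ inv_continuous])

lemma mem_carrier: "f \<in> L \<Longrightarrow> x \<in> space M \<Longrightarrow> f x \<in> carrier G"
  unfolding carrier_eq by (rule mem_S)

lemma carrier_H: "carrier H = L0" by (simp add: L0_group_def)

lemma one_H: "\<one>\<^bsub>H\<^esub> = cl (\<lambda>_. \<one>)" by (simp add: L0_group_def)

lemma mult_H:
  assumes f: "f \<in> L" and g: "g \<in> L"
  shows "cl f \<otimes>\<^bsub>H\<^esub> cl g = cl (\<lambda>x. f x \<otimes> g x)"
proof -
  have eq: "cl (\<lambda>x. f' x \<otimes> g' x) = cl (\<lambda>x. f x \<otimes> g x)" if f': "f' \<in> cl f" and g': "g' \<in> cl g" for f' g'
  proof -
    have "f' \<in> L" "AE x in M. f x = f' x" "g' \<in> L" "AE x in M. g x = g' x"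
      using f' g' unfolding ae_eq_rel_def by blast+
    moreover have "AE x in M. f' x \<otimes> g' x = f x \<otimes> g x"
      using calculation(2,4) by eventually_elim simp
    ultimately show ?thesis by (subst cl_eq_iff) (simp_all add: mult_L f g)
  qed
  have "cl f \<otimes>\<^bsub>H\<^esub> cl g = (\<Union>f'\<in>cl f. \<Union>g'\<in>cl g. cl (\<lambda>x. f' x \<otimes> g' x))"
    by (simp add: L0_group_def)
  also have "\<dots> = (\<Union>f'\<in>cl f. \<Union>g'\<in>cl g. cl (\<lambda>x. f x \<otimes> g x))"
    by (intro SUP_cong refl eq)
  also have "\<dots> = cl (\<lambda>x. f x \<otimes> g x)"
    using mem_cl[OF f] mem_cl[OF g] by blast
  finally show ?thesis .
qed

lemma cl_cong: "f \<in> L \<Longrightarrow> g \<in> L \<Longrightarrow> (\<And>x. x \<in> space M \<Longrightarrow> f x = g x) \<Longrightarrow> cl f = cl g"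
  by (subst cl_eq_iff) (auto intro: AE_I2)

lemma group_H: "group H"
proof (rule groupI)
  show "\<one>\<^bsub>H\<^esub> \<in> carrier H" unfolding carrier_H one_H by (rule cl_in_L0[OF one_L])
next
  fix A assume "A \<in> carrier H"
  then obtain f where f: "f \<in> L" "A = cl f" unfolding carrier_H by (rule L0E)
  show "\<one>\<^bsub>H\<^esub> \<otimes>\<^bsub>H\<^esub> A = A"
    unfolding one_H f(2) mult_H[OF one_L f(1)]
    by (rule cl_cong) (simp_all add: mult_L one_L f(1) mem_carrier)
  show "\<exists>B\<in>carrier H. B \<otimes>\<^bsub>H\<^esub> A = \<one>\<^bsub>H\<^esub>"
  proof (rule bexI)
    show "cl (\<lambda>x. inv (f x)) \<in> carrier H" unfolding carrier_H by (rule cl_in_L0[OF inv_L[OF f(1)]])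
    show "cl (\<lambda>x. inv (f x)) \<otimes>\<^bsub>H\<^esub> A = \<one>\<^bsub>H\<^esub>"
      unfolding one_H f(2) mult_H[OF inv_L[OF f(1)] f(1)]
      by (rule cl_cong) (simp_all add: mult_L one_L inv_L f(1) mem_carrier)
  qed
  fix B assume "B \<in> carrier H"
  then obtain g where g: "g \<in> L" "B = cl g" unfolding carrier_H by (rule L0E)
  show "A \<otimes>\<^bsub>H\<^esub> B \<in> carrier H"
    unfolding carrier_H f(2) g(2) mult_H[OF f(1) g(1)] by (rule cl_in_L0[OF mult_L[OF f(1) g(1)]])
  fix C assume "C \<in> carrier H"
  then obtain h where h: "h \<in> L" "C = cl h" unfolding carrier_H by (rule L0E)
  show "A \<otimes>\<^bsub>H\<^esub> B \<otimes>\<^bsub>H\<^esub> C = A \<otimes>\<^bsub>H\<^esub> (B \<otimes>\<^bsub>H\<^esub> C)"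
    unfolding f(2) g(2) h(2) mult_H[OF f(1) g(1)] mult_H[OF g(1) h(1)]
      mult_H[OF mult_L[OF f(1) g(1)] h(1)] mult_H[OF f(1) mult_L[OF g(1) h(1)]]
    by (rule cl_cong) (simp_all add: mult_L f(1) g(1) h(1) mem_carrier G.m_assoc)
qed

sublocale H: group H by (rule group_H)

lemma inv_H:
  assumes f: "f \<in> L"
  shows "inv\<^bsub>H\<^esub> (cl f) = cl (\<lambda>x. inv (f x))"
proof (rule H.inv_equality)
  show "cl (\<lambda>x. inv (f x)) \<otimes>\<^bsub>H\<^esub> cl f = \<one>\<^bsub>H\<^esub>"
    unfolding one_H mult_H[OF inv_L[OF f] f]
    by (rule cl_cong) (simp_all add: mult_L one_L inv_L f mem_carrier)
qed (simp_all add: carrier_H cl_in_L0 inv_L f)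

lemma topological_group_metric: "topological_group H L0.mtopology"
  unfolding topological_group_def
proof (intro conjI)
  show "group H" by (rule group_H)
  show "topspace L0.mtopology = carrier H" by (simp add: carrier_H)
  show "continuous_map (prod_topology L0.mtopology L0.mtopology) L0.mtopology (\<lambda>(A, B). A \<otimes>\<^bsub>H\<^esub> B)"
    by (rule continuous_map_L0[OF mult_continuous mult_H])
  have "continuous_map (prod_topology T T) T ((\<lambda>a. inv a) \<circ> fst)"
    by (rule continuous_map_compose[OF continuous_map_fst inv_continuous])
  then have "continuous_map (prod_topology T T) T (\<lambda>(a, b). inv a)"
    by (simp add: o_def case_prod_unfold)
  then have "continuous_map (prod_topology L0.mtopology L0.mtopology) L0.mtopology (\<lambda>(A, B). inv\<^bsub>H\<^esub> A)"
    by (rule continuous_map_L0) (rule inv_H)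
  then have "continuous_map L0.mtopology L0.mtopology ((\<lambda>(A, B). inv\<^bsub>H\<^esub> A) \<circ> (\<lambda>A. (A, A)))"
    by (rule continuous_map_compose[rotated]) (simp add: continuous_map_pairedI)
  then show "continuous_map L0.mtopology L0.mtopology (\<lambda>A. inv\<^bsub>H\<^esub> A)"
    by (simp add: o_def)
qed

subsection \<open>Agreement with the topology of convergence in measure\<close>

text \<open>
  Markov's inequality: if \<open>U\<close> contains the ball of radius \<open>r\<close> around the identity, then
  \<open>f x \<notin> U\<close> forces \<open>d \<one> (f x) \<ge> r\<close>.
\<close>

lemma mball_subset_basic_nhd:
  assumes U: "openin T U" "\<one> \<in> U" and \<epsilon>: "0 < \<epsilon>"
  obtains \<delta> where "\<delta> > 0" "L0.mball \<one>\<^bsub>H\<^esub> \<delta> \<subseteq> L0_basic_nhd M G T U \<epsilon>"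
proof -
  obtain r where r: "r > 0" "base.mball \<one> r \<subseteq> U"
    using U unfolding base.openin_mtopology by blast
  have "L0.mball \<one>\<^bsub>H\<^esub> (\<epsilon> * r) \<subseteq> L0_basic_nhd M G T U \<epsilon>"
  proof
    fix A assume A: "A \<in> L0.mball \<one>\<^bsub>H\<^esub> (\<epsilon> * r)"
    then have "A \<in> L0" by simp
    then obtain f where f: "f \<in> L" "A = cl f" by (rule L0E)
    have small: "fdist (\<lambda>_. \<one>) f < \<epsilon> * r"
      using A unfolding f(2) one_H by (simp add: L0_dist_cl f(1) one_L)
    have meas: "(\<lambda>x. d \<one> (f x)) \<in> borel_measurable M" by (rule measurable_dist[OF one_L f(1)])
    have "measure M {x \<in> space M. f x \<notin> U} \<le> measure M {x \<in> space M. r \<le> d \<one> (f x)}"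
    proof (rule finite_measure_mono)
      show "{x \<in> space M. f x \<notin> U} \<subseteq> {x \<in> space M. r \<le> d \<one> (f x)}"
        using r(2) mem_S[OF f(1)] G.one_closed unfolding carrier_eq
        by (auto simp: subset_iff not_le[symmetric])
      show "{x \<in> space M. r \<le> d \<one> (f x)} \<in> sets M" using meas by measurable
    qed
    also have "\<dots> \<le> fdist (\<lambda>_. \<one>) f / r"
      unfolding fdist_def
      by (rule integral_Markov_inequality_measure[where A = "{}"])
        (use r(1) integrable_dist[OF one_L f(1)] in auto)
    also have "\<dots> < \<epsilon>" using small r(1) by (simp add: field_simps)
    finally show "A \<in> L0_basic_nhd M G T U \<epsilon>"
      using \<open>A \<in> L0\<close> mem_cl[OF f(1)] unfolding L0_basic_nhd_def carrier_H f(2) by auto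
  qed
  then show thesis using \<epsilon> r(1) by (intro that[of "\<epsilon> * r"]) simp_all
qed

text \<open>Conversely, \<open>d \<one> (f x)\<close> is at most \<open>\<delta>/2\<close>, or at most \<open>1\<close> on a set of measure below \<open>\<delta>/2\<close>.\<close>

lemma basic_nhd_subset_mball:
  assumes \<delta>: "\<delta> > 0"
  shows "L0_basic_nhd M G T (base.mball \<one> (\<delta>/2)) (\<delta>/2) \<subseteq> L0.mball \<one>\<^bsub>H\<^esub> \<delta>"
proof
  fix A assume "A \<in> L0_basic_nhd M G T (base.mball \<one> (\<delta>/2)) (\<delta>/2)"
  then obtain f where A: "A \<in> L0" "f \<in> A"
    and small: "measure M {x \<in> space M. f x \<notin> base.mball \<one> (\<delta>/2)} < \<delta>/2"
    unfolding L0_basic_nhd_def carrier_H by blast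
  note f = mem_L0E[OF A]
  let ?B = "{x \<in> space M. f x \<notin> base.mball \<one> (\<delta>/2)}"
  have B: "?B \<in> sets M" by (rule sets_not_in_open[OF f(1) base.openin_mball])
  then have intB: "integrable M (indicator ?B :: 'x \<Rightarrow> real)"
    by (intro integrable_real_indicator) (simp_all add: emeasure_finite less_top[symmetric])
  have "fdist (\<lambda>_. \<one>) f \<le> (\<integral>x. \<delta>/2 + indicator ?B x \<partial>M)"
    unfolding fdist_def
  proof (rule integral_mono[OF integrable_dist[OF one_L f(1)]])
    show "integrable M (\<lambda>x. \<delta>/2 + indicator ?B x :: real)" using intB by simp
    fix x assume x: "x \<in> space M"
    show "d \<one> (f x) \<le> \<delta>/2 + indicator ?B x"
    proof (cases "x \<in> ?B")
      case True
      then show ?thesis using d_le_one[of \<one> "f x"] \<delta> by simp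
    next
      case False
      then have "f x \<in> base.mball \<one> (\<delta>/2)" using x by blast
      then show ?thesis by (simp add: less_imp_le)
    qed
  qed
  also have "\<dots> = \<delta>/2 + measure M ?B"
    using intB B by (simp add: prob_space)
  also have "\<dots> < \<delta>" using small by simp
  finally have "L0_dist \<one>\<^bsub>H\<^esub> A < \<delta>"
    unfolding one_H f(2) by (simp add: L0_dist_cl one_L f(1))
  then show "A \<in> L0.mball \<one>\<^bsub>H\<^esub> \<delta>"
    using A(1) cl_in_L0[OF one_L] by (simp add: one_H)
qed

lemma translation_continuous:
  assumes A: "A \<in> carrier H"
  shows "continuous_map L0.mtopology L0.mtopology (\<lambda>B. A \<otimes>\<^bsub>H\<^esub> B)"
proof -
  have "continuous_map (prod_topology L0.mtopology L0.mtopology) L0.mtopology (\<lambda>(A, B). A \<otimes>\<^bsub>H\<^esub> B)"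
    using topological_group_metric unfolding topological_group_def by blast
  moreover have "continuous_map L0.mtopology (prod_topology L0.mtopology L0.mtopology) (\<lambda>B. (A, B))"
    using A unfolding carrier_H by (intro continuous_map_pairedI) simp_all
  ultimately have "continuous_map L0.mtopology L0.mtopology ((\<lambda>(A, B). A \<otimes>\<^bsub>H\<^esub> B) \<circ> (\<lambda>B. (A, B)))"
    by (rule continuous_map_compose[rotated])
  then show ?thesis by (simp add: o_def)
qed

text \<open>
  Around the identity, balls and basic neighbourhoods refine each other. Translations by \<open>A\<close> and by
  its inverse are continuous for the metric, which transports this to every point \<open>A\<close>.
\<close>

lemma L0_topology_eq: "L0_topology M G T = L0.mtopology"
  unfolding topology_eq openin_L0_topology[OF finite_measure_axioms]
proof (intro allI iffI)
  fix W assume W: "openin L0.mtopology W"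
  show "L0_open M G T W"
    unfolding L0_open_def
  proof (intro conjI ballI)
    show sub: "W \<subseteq> carrier H" using openin_subset[OF W] by (simp add: carrier_H)
    fix A assume A: "A \<in> W"
    then have Ac: "A \<in> carrier H" using sub by blast
    let ?V = "{B \<in> L0. A \<otimes>\<^bsub>H\<^esub> B \<in> W}"
    have "openin L0.mtopology ?V"
      using openin_continuous_map_preimage[OF translation_continuous[OF Ac] W] by simp
    moreover have "\<one>\<^bsub>H\<^esub> \<in> ?V"
      using A Ac H.one_closed unfolding carrier_H[symmetric] by simp
    ultimately obtain \<delta> where \<delta>: "\<delta> > 0" "L0.mball \<one>\<^bsub>H\<^esub> \<delta> \<subseteq> ?V"
      unfolding L0.openin_mtopology by blast
    show "\<exists>U \<epsilon>. openin T U \<and> \<one> \<in> U \<and> 0 < \<epsilon> \<and> (\<lambda>B. A \<otimes>\<^bsub>H\<^esub> B) ` L0_basic_nhd M G T U \<epsilon> \<subseteq> W"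
    proof (intro exI conjI)
      show "openin T (base.mball \<one> (\<delta>/2))" by simp
      show "\<one> \<in> base.mball \<one> (\<delta>/2)" using \<delta>(1) G.one_closed by (simp add: carrier_eq)
      show "0 < \<delta>/2" using \<delta>(1) by simp
      show "(\<lambda>B. A \<otimes>\<^bsub>H\<^esub> B) ` L0_basic_nhd M G T (base.mball \<one> (\<delta>/2)) (\<delta>/2) \<subseteq> W"
        using basic_nhd_subset_mball[OF \<delta>(1)] \<delta>(2) by blast
    qed
  qed
next
  fix W assume W: "L0_open M G T W"
  show "openin L0.mtopology W"
    unfolding L0.openin_mtopology
  proof (intro conjI allI impI)
    show sub: "W \<subseteq> L0" using W by (simp add: L0_open_def carrier_H)
    fix A assume A: "A \<in> W"
    then have Ac: "A \<in> carrier H" using sub carrier_H by blast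
    have iA: "inv\<^bsub>H\<^esub> A \<in> carrier H" using Ac by simp
    obtain U \<epsilon> where U: "openin T U" "\<one> \<in> U" "0 < \<epsilon>"
      and UW: "(\<lambda>B. A \<otimes>\<^bsub>H\<^esub> B) ` L0_basic_nhd M G T U \<epsilon> \<subseteq> W"
      using W A unfolding L0_open_def by blast
    obtain \<delta> where \<delta>: "\<delta> > 0" "L0.mball \<one>\<^bsub>H\<^esub> \<delta> \<subseteq> L0_basic_nhd M G T U \<epsilon>"
      using U by (rule mball_subset_basic_nhd)
    let ?V = "{B \<in> L0. inv\<^bsub>H\<^esub> A \<otimes>\<^bsub>H\<^esub> B \<in> L0.mball \<one>\<^bsub>H\<^esub> \<delta>}"
    have "openin L0.mtopology ?V"
      using openin_continuous_map_preimage[OF translation_continuous[OF iA] L0.openin_mball] by simp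
    moreover have "A \<in> ?V"
      using Ac \<delta>(1) H.one_closed by (simp add: carrier_H H.l_inv)
    ultimately obtain \<rho> where "\<rho> > 0" and V: "L0.mball A \<rho> \<subseteq> ?V"
      unfolding L0.openin_mtopology by blast
    have "?V \<subseteq> W"
    proof
      fix B assume B: "B \<in> ?V"
      then have Bc: "B \<in> carrier H" by (simp add: carrier_H)
      have "inv\<^bsub>H\<^esub> A \<otimes>\<^bsub>H\<^esub> B \<in> L0_basic_nhd M G T U \<epsilon>" using B \<delta>(2) by blast
      then have "A \<otimes>\<^bsub>H\<^esub> (inv\<^bsub>H\<^esub> A \<otimes>\<^bsub>H\<^esub> B) \<in> W" using UW by blast
      then show "B \<in> W" using Ac Bc iA by (simp add: H.m_assoc[symmetric])
    qed
    then show "\<exists>r>0. L0.mball A r \<subseteq> W" using V \<open>\<rho> > 0\<close> by blast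
  qed
qed

lemma topological_group_L0: "topological_group H (L0_topology M G T)"
  unfolding L0_topology_eq by (rule topological_group_metric)

subsection \<open>Subgroups generated by few small elements\<close>

text \<open>
  An element of a generated subgroup is a word; evaluating the same word pointwise on the chosen
  representatives gives a representative whose values are controlled at every point.
\<close>

lemma generate_pointwise:
  assumes f: "\<And>i. i \<in> I \<Longrightarrow> f i \<in> L" and A: "A \<in> generate H ((\<lambda>i. cl (f i)) ` I)"
  shows "\<exists>h\<in>L. A = cl h \<and> (\<forall>x\<in>space M. h x \<in> generate G ((\<lambda>i. f i x) ` I))"
  using A
proof induction
  case one
  show ?case
    by (intro bexI[OF _ one_L] conjI one_H ballI generate.one)
next
  case (incl A)
  then obtain i where i: "i \<in> I" "A = cl (f i)" by blast
  then show ?case by (intro bexI[OF _ f[OF i(1)]] conjI ballI generate.incl) auto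
next
  case (inv A)
  then obtain i where i: "i \<in> I" "A = cl (f i)" by blast
  show ?case
    by (intro bexI[OF _ inv_L[OF f[OF i(1)]]] conjI ballI generate.inv)
      (use i inv_H[OF f[OF i(1)]] in auto)
next
  case (eng A B)
  then obtain h k where hk: "h \<in> L" "A = cl h" "k \<in> L" "B = cl k"
    and x: "\<And>x. x \<in> space M \<Longrightarrow> h x \<in> generate G ((\<lambda>i. f i x) ` I)"
      "\<And>x. x \<in> space M \<Longrightarrow> k x \<in> generate G ((\<lambda>i. f i x) ` I)"
    by blast
  show ?case
    by (intro bexI[OF _ mult_L[OF hk(1,3)]] conjI ballI generate.eng x)
      (simp add: hk(2,4) mult_H[OF hk(1,3)])
qed

lemma quasi_non_archimedean_L0:
  assumes qna: "quasi_non_archimedean G T"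
  shows "quasi_non_archimedean H (L0_topology M G T)"
  unfolding quasi_non_archimedean_def
proof (intro conjI topological_group_L0 allI impI)
  fix n :: nat and V assume "nhd_of (L0_topology M G T) \<one>\<^bsub>H\<^esub> V"
  then obtain W where W: "L0_open M G T W" "\<one>\<^bsub>H\<^esub> \<in> W" "W \<subseteq> V"
    by (auto simp: nhd_of_def openin_L0_topology[OF finite_measure_axioms])
  then obtain U \<epsilon> where U: "openin T U" "\<one> \<in> U" and \<epsilon>: "0 < \<epsilon>"
    and UW: "(\<lambda>B. \<one>\<^bsub>H\<^esub> \<otimes>\<^bsub>H\<^esub> B) ` L0_basic_nhd M G T U \<epsilon> \<subseteq> W"
    unfolding L0_open_def by blast
  have UV: "L0_basic_nhd M G T U \<epsilon> \<subseteq> V"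
  proof
    fix B assume B: "B \<in> L0_basic_nhd M G T U \<epsilon>"
    then have "B \<in> carrier H" by (simp add: L0_basic_nhd_def)
    then have "\<one>\<^bsub>H\<^esub> \<otimes>\<^bsub>H\<^esub> B = B" by (rule H.l_one)
    then have "B \<in> W" using imageI[OF B, of "\<lambda>B. \<one>\<^bsub>H\<^esub> \<otimes>\<^bsub>H\<^esub> B"] UW by auto
    then show "B \<in> V" using W(3) by blast
  qed
  have "nhd_of T \<one> U" using U openin_subset[OF U(1)] by (auto simp: nhd_of_def)
  then obtain U' where U': "nhd_of T \<one> U'" "U' \<subseteq> U"
    and gen: "\<And>g :: nat \<Rightarrow> 'a. (\<forall>i<n. g i \<in> U') \<Longrightarrow> generate G (g ` {..<n}) \<subseteq> U"
    using qna unfolding quasi_non_archimedean_def by meson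
  obtain U0 where U0: "openin T U0" "\<one> \<in> U0" "U0 \<subseteq> U'"
    using U'(1) unfolding nhd_of_def by blast
  \<comment> \<open>Dividing by \<open>n + 1\<close> keeps the bound strict after \<open>n\<close> summands and covers \<open>n = 0\<close>.\<close>
  define \<eta> where "\<eta> = \<epsilon> / real (Suc n)"
  have \<eta>: "\<eta> > 0" "\<eta> \<le> \<epsilon>" using \<epsilon> by (auto simp: \<eta>_def field_simps)
  let ?N = "L0_basic_nhd M G T U0 \<eta>"
  obtain \<delta> where \<delta>: "\<delta> > 0" "L0.mball \<one>\<^bsub>H\<^esub> \<delta> \<subseteq> ?N"
    using U0(1,2) \<eta>(1) by (rule mball_subset_basic_nhd)
  show "\<exists>N. nhd_of (L0_topology M G T) \<one>\<^bsub>H\<^esub> N \<and> N \<subseteq> V \<and>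
      (\<forall>g :: nat \<Rightarrow> _. (\<forall>i<n. g i \<in> N) \<longrightarrow> generate H (g ` {..<n}) \<subseteq> V)"
  proof (intro exI[of _ ?N] conjI allI impI)
    show "nhd_of (L0_topology M G T) \<one>\<^bsub>H\<^esub> ?N"
      unfolding L0_topology_eq nhd_of_def
    proof (intro conjI exI[of _ "L0.mball \<one>\<^bsub>H\<^esub> \<delta>"])
      show "?N \<subseteq> topspace L0.mtopology" by (auto simp: L0_basic_nhd_def carrier_H)
      show "\<one>\<^bsub>H\<^esub> \<in> L0.mball \<one>\<^bsub>H\<^esub> \<delta>" using \<delta>(1) H.one_closed by (simp add: carrier_H)
    qed (use \<delta>(2) in auto)
    have "?N \<subseteq> L0_basic_nhd M G T U \<epsilon>"
      using U0(3) U'(2) \<eta>(2) by (intro L0_basic_nhd_mono finite_measure_axioms U0(1)) auto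
    then show "?N \<subseteq> V" using UV by blast
    fix g :: "nat \<Rightarrow> ('x \<Rightarrow> 'a) set" assume g: "\<forall>i<n. g i \<in> ?N"
    define rep where "rep i f \<longleftrightarrow> f \<in> L \<and> g i = cl f \<and> measure M {x \<in> space M. f x \<notin> U0} < \<eta>" for i f
    have "\<exists>f. rep i f" if "i < n" for i
    proof -
      have "g i \<in> ?N" using g that by simp
      then obtain f where "g i \<in> L0" "f \<in> g i" "measure M {x \<in> space M. f x \<notin> U0} < \<eta>"
        unfolding L0_basic_nhd_def carrier_H by (elim CollectE conjE bexE)
      then show ?thesis unfolding rep_def using mem_L0E[of "g i" f] by (intro exI[of _ f] conjI)
    qed
    then obtain f where "\<And>i. i < n \<Longrightarrow> rep i (f i)" by metis
    then have f: "\<And>i. i < n \<Longrightarrow> f i \<in> L" "\<And>i. i < n \<Longrightarrow> g i = cl (f i)"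
      and small: "\<And>i. i < n \<Longrightarrow> measure M {x \<in> space M. f i x \<notin> U0} < \<eta>"
      unfolding rep_def by simp_all
    have meas: "{x \<in> space M. f i x \<notin> U0} \<in> sets M" if "i < n" for i
      by (rule sets_not_in_open[OF f(1)[OF that] U0(1)])
    have gf: "g ` {..<n} = (\<lambda>i. cl (f i)) ` {..<n}" using f(2) by (intro image_cong) auto
    show "generate H (g ` {..<n}) \<subseteq> V"
    proof
      fix A assume "A \<in> generate H (g ` {..<n})"
      then obtain h where h: "h \<in> L" "A = cl h"
        and word: "\<And>x. x \<in> space M \<Longrightarrow> h x \<in> generate G ((\<lambda>i. f i x) ` {..<n})"
        using generate_pointwise[of "{..<n}" f A] f(1) unfolding gf by blast
      have "measure M {x \<in> space M. h x \<notin> U} \<le> measure M (\<Union>i<n. {x \<in> space M. f i x \<notin> U0})"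
      proof (rule finite_measure_mono)
        show "{x \<in> space M. h x \<notin> U} \<subseteq> (\<Union>i<n. {x \<in> space M. f i x \<notin> U0})"
        proof (rule subsetI, rule ccontr)
          fix x assume x: "x \<in> {x \<in> space M. h x \<notin> U}" and "x \<notin> (\<Union>i<n. {x \<in> space M. f i x \<notin> U0})"
          then have "\<forall>i<n. f i x \<in> U'" using U0(3) by blast
          then have "generate G ((\<lambda>i. f i x) ` {..<n}) \<subseteq> U" by (rule gen)
          then show False using word x by blast
        qed
        show "(\<Union>i<n. {x \<in> space M. f i x \<notin> U0}) \<in> sets M" using meas by (intro sets.finite_UN) auto
      qed
      also have "\<dots> \<le> (\<Sum>i<n. measure M {x \<in> space M. f i x \<notin> U0})"
        using meas by (intro finite_measure_subadditive_finite) auto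
      also have "\<dots> \<le> (\<Sum>i<n. \<eta>)" using small by (intro sum_mono) (simp add: less_imp_le)
      also have "\<dots> < \<epsilon>" using \<epsilon> by (simp add: \<eta>_def field_simps)
      finally have "A \<in> L0_basic_nhd M G T U \<epsilon>"
        using mem_cl[OF h(1)] cl_in_L0[OF h(1)] unfolding L0_basic_nhd_def carrier_H h(2) by auto
      then show "A \<in> V" using UV by blast
    qed
  qed
qed

subsection \<open>Constant maps\<close>

lemma const_hom: "(\<lambda>a. cl (\<lambda>_. a)) \<in> hom G H"
proof (rule homI)
  fix a b assume ab: "a \<in> carrier G" "b \<in> carrier G"
  have L: "(\<lambda>_. c) \<in> L" if "c \<in> carrier G" for c
    using that by (intro measurable_borel_of_const) (simp add: carrier_eq)
  show "cl (\<lambda>_. a) \<in> carrier H" unfolding carrier_H by (intro cl_in_L0 L ab)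
  show "cl (\<lambda>_. a \<otimes> b) = cl (\<lambda>_. a) \<otimes>\<^bsub>H\<^esub> cl (\<lambda>_. b)"
    by (simp only: mult_H L ab)
qed

lemma const_embedding: "topological_group_embedding G T H (L0_topology M G T) (\<lambda>a. cl (\<lambda>_. a))"
  unfolding topological_group_embedding_def L0_topology_eq
  using const_hom embedding_map_const by blast

end

section \<open>Polish groups\<close>

lemma completely_metrizable_space_bounded_metric:
  assumes "completely_metrizable_space T"
  obtains S d where "Metric_space S d" "Metric_space.mcomplete S d" "Metric_space.mtopology S d = T"
    "\<And>a b. d a b \<le> 1"
proof -
  obtain S d where Sd: "Metric_space S d" "Metric_space.mcomplete S d" "T = Metric_space.mtopology S d"
    using assms unfolding completely_metrizable_space_def by blast
  interpret Metric_space S d by (rule Sd(1))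
  show thesis
  proof (rule that)
    show "Metric_space S (capped_dist 1)" by (rule capped_dist)
    show "Metric_space.mcomplete S (capped_dist 1)"
      using Sd(2) by (simp add: mcomplete_capped_metric)
    show "Metric_space.mtopology S (capped_dist 1) = T"
      unfolding Sd(3) by (rule mtopology_capped_metric)
    show "capped_dist 1 a b \<le> 1" for a b by (simp add: capped_dist_def)
  qed
qed

theorem proposition5p4:
  fixes G :: "('a, 'b) monoid_scheme" and T :: "'a topology"
  assumes "polish_group G T"
    and "quasi_non_archimedean G T"
  shows "(\<forall>M :: 'x measure. standard_prob_space M \<longrightarrow>
            quasi_non_archimedean (L0_group M G T) (L0_topology M G T)) \<and>
         (\<exists>(H :: (real \<Rightarrow> 'a) set monoid) S \<phi>.
            polish_group H S \<and> quasi_non_archimedean H S \<and> connected_space S \<and>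
            topological_group_embedding G T H S \<phi>)"
proof -
  have tg: "topological_group G T" and sep: "separable_space T" and cm: "completely_metrizable_space T"
    using assms(1) by (simp_all add: polish_group_def)
  obtain S d where ms: "Metric_space S d" and complete: "Metric_space.mcomplete S d"
    and top: "Metric_space.mtopology S d = T" and le: "\<And>a b. d a b \<le> 1"
    using cm by (rule completely_metrizable_space_bounded_metric) blast
  have loc: "L0_metric_group N S d G" if "prob_space N" for N :: "'y measure"
    using that ms tg sep le
    by (simp add: L0_metric_group_def L0_metric_def L0_metric_axioms_def
        L0_metric_group_axioms_def top)
  show ?thesis
  proof (intro conjI allI impI)
    fix M :: "'x measure" assume "standard_prob_space M"
    then have "prob_space M" by (simp add: standard_prob_space_def)
    then interpret L0_metric_group M S d G by (rule loc)
    show "quasi_non_archimedean (L0_group M G T) (L0_topology M G T)"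
      using quasi_non_archimedean_L0 assms(2) unfolding top by blast
  next
    interpret I: L0_metric_group unit_interval S d G
      by (rule loc[OF prob_space_unit_interval])
    interpret J: L0_metric_unit_interval S d ..
    have "S \<noteq> {}" using I.G.one_closed I.carrier_eq by blast
    then have "polish_group I.H I.L0.mtopology"
      unfolding polish_group_def
      using I.topological_group_metric J.separable_L0_unit_interval
        I.L0.completely_metrizable_space_mtopology[OF I.mcomplete_L0[OF complete]]
      by blast
    moreover have "quasi_non_archimedean I.H I.L0.mtopology"
      using I.quasi_non_archimedean_L0 assms(2) unfolding top I.L0_topology_eq[unfolded top] by simp
    moreover have "connected_space I.L0.mtopology" by (rule J.connected_L0_unit_interval)
    moreover have "topological_group_embedding G T I.H I.L0.mtopology (\<lambda>a. I.cl (\<lambda>_. a))"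
      using I.const_embedding unfolding top I.L0_topology_eq[unfolded top] .
    ultimately show "\<exists>(H :: (real \<Rightarrow> 'a) set monoid) S \<phi>.
            polish_group H S \<and> quasi_non_archimedean H S \<and> connected_space S \<and>
            topological_group_embedding G T H S \<phi>"
      by blast
  qed
qed

end
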